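(* Let $G$ be a finite abelian group (written additively) with $\exp(G)=n$, and let $S=A\cup B$ be a subset of $G\setminus\{0\}$, where $A\cap B=\emptyset$, $A=-A$ and $B\cap(-B)=\emptyset$. Let $F=\{k\in\mathbb{Z}_{4n}^*\mid k\equiv 1\pmod 4\}$. Then the mixed Cayley graph $\Gamma=\mathrm{Cay}(G,S)$ is integral if and only if $kA=A$ for all $k\in\mathbb{Z}_{4n}^*$ and $k_1B=B$ for all $k_1\in F$; or equivalently, if and only if $A$ is a union of some orbits of $\mathbb{Z}_{4n}^*$ acting on $G$ and $B$ is a union of some orbits of $F$ acting on $G$.
   Context: A mixed graph $\Gamma=(V,E,\vec{E})$ has a vertex set $V$, a set $E$ of undirected edges $uv$ and a set $\vec{E}$ of directed edges (arcs) $(u,v)$, with no multiple edges and no loops. Its Hermitian adjacency matrix is $H(\Gamma)=(h_{uv})_{u,v\in V}$ with $h_{uv}=1$ if $uv\in E$, $h_{uv}=\mathbf{i}$ if $(u,v)\in\vec{E}$, $h_{uv}=-\mathbf{i}$ if $(v,u)\in\vec{E}$, and $h_{uv}=0$ otherwise, where $\mathbf{i}=\sqrt{-1}$. The eigenvalues of $H(\Gamma)$ are the Hermitian eigenvalues of $\Gamma$. $\Gamma$ is called integral if all its Hermitian eigenvalues are integers. For an additive abelian group $G$ and $S=A\cup B\subseteq G\setminus\{0\}$ with $A\cap B=\emptyset$, $A=-A$, $B\cap(-B)=\emptyset$, the mixed Cayley graph $\mathrm{Cay}(G,S)$ has vertex set $G$, an undirected edge between $g$ and $h$ if $h-g\in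 A$, and an arc from $g$ to $h$ if $h-g\in B$. The exponent $\exp(G)$ is the least common multiple of the orders of the elements of $G$. $\mathbb{Z}_t^*$ is the multiplicative group of units of the ring $\mathbb{Z}_t$ of integers modulo $t$. $\mathbb{Z}_{4n}^*$ (and hence its subgroup $F$) acts on $G$ by $k\cdot g=kg$ (the $k$-th multiple of $g$, well defined since $ng=0$), and for $X\subseteq G$, $kX=\{kx\mid x\in X\}$ and $-X=\{-x\mid x\in X\}$. A union of orbits may be empty. *)

theory Defs
  imports Complex_Main "HOL-Number_Theory.Residues" "HOL-Algebra.Group_Action"
begin

section \<open>Mixed graphs and their Hermitian eigenvalues\<close>

record 'v mixed_graph =
  verts :: "'v set"
  edges :: "'v set set"
  arcs  :: "('v \<times> 'v) set"

text \<open>The last axiom excludes multiple edges: two vertices are joined by at most one of an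
  undirected edge and the two possible arcs.\<close>

locale finite_mixed_graph =
  fixes \<Gamma> :: "'v mixed_graph"
  assumes finite_verts: "finite (verts \<Gamma>)"
    and edges_wf: "e \<in> edges \<Gamma> \<Longrightarrow> \<exists>u v. e = {u, v} \<and> u \<in> verts \<Gamma> \<and> v \<in> verts \<Gamma> \<and> u \<noteq> v"
    and arcs_wf: "(u, v) \<in> arcs \<Gamma> \<Longrightarrow> u \<in> verts \<Gamma> \<and> v \<in> verts \<Gamma> \<and> u \<noteq> v"
    and no_multi: "(u, v) \<in> arcs \<Gamma> \<Longrightarrow> (v, u) \<notin> arcs \<Gamma> \<and> {u, v} \<notin> edges \<Gamma>"

definition hermitian_adj :: "'v mixed_graph \<Rightarrow> 'v \<Rightarrow> 'v \<Rightarrow> complex" where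
  "hermitian_adj \<Gamma> u v =
     (if {u, v} \<in> edges \<Gamma> then 1
      else if (u, v) \<in> arcs \<Gamma> then \<i>
      else if (v, u) \<in> arcs \<Gamma> then - \<i>
      else 0)"

text \<open>The matrix is indexed by the vertex set, so vectors are functions on \<^term>\<open>verts \<Gamma>\<close>; their
  values elsewhere are irrelevant.\<close>

definition hermitian_eigenvalue :: "'v mixed_graph \<Rightarrow> complex \<Rightarrow> bool" where
  "hermitian_eigenvalue \<Gamma> \<mu> \<longleftrightarrow>
     (\<exists>x :: 'v \<Rightarrow> complex. (\<exists>u\<in>verts \<Gamma>. x u \<noteq> 0) \<and>
        (\<forall>u\<in>verts \<Gamma>. (\<Sum>v\<in>verts \<Gamma>. hermitian_adj \<Gamma> u v * x v) = \<mu> * x u))"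

definition integral_mixed_graph :: "'v mixed_graph \<Rightarrow> bool" where
  "integral_mixed_graph \<Gamma> \<longleftrightarrow> (\<forall>\<mu>. hermitian_eigenvalue \<Gamma> \<mu> \<longrightarrow> \<mu> \<in> \<int>)"


section \<open>Mixed Cayley graphs\<close>

text \<open>Additive abelian groups are those of the locale \<^locale>\<open>abelian_group\<close>, which is stated for ring
  records but constrains only the carrier, the addition and the zero.

  The connection set is passed as its symmetric part \<open>A\<close> and its antisymmetric part \<open>B\<close>.\<close>

definition mixed_cayley :: "('g, 'm) ring_scheme \<Rightarrow> 'g set \<Rightarrow> 'g set \<Rightarrow> 'g mixed_graph" where
  "mixed_cayley G A B =
     \<lparr>verts = carrier G,
      edges = {{g, h} | g h. g \<in> carrier G \<and> h \<in> carrier G \<and> h \<ominus>\<^bsub>G\<^esub> g \<in> A},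
      arcs = {(g, h). g \<in> carrier G \<and> h \<in> carrier G \<and> h \<ominus>\<^bsub>G\<^esub> g \<in> B}\<rparr>"

lemma (in abelian_group) minus_diff_eq:
  assumes "x \<in> carrier G" "y \<in> carrier G"
  shows "\<ominus> (x \<ominus> y) = y \<ominus> x"
  using assms by (simp add: a_minus_def minus_add a_comm)

lemma (in abelian_group) finite_mixed_graph_mixed_cayley:
  assumes fin: "finite (carrier G)"
    and sub: "A \<union> B \<subseteq> carrier G - {\<zero>}"
    and disj: "A \<inter> B = {}"
    and A: "A = a_inv G ` A"
    and B: "B \<inter> a_inv G ` B = {}"
  shows "finite_mixed_graph (mixed_cayley G A B)"
proof -
  have ne: "g \<noteq> h" if "g \<in> carrier G" "h \<ominus> g \<in> A \<union> B" for g h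
    using that sub by (auto simp: a_minus_def r_neg)
  have symA: "g \<ominus> h \<in> A" if "g \<in> carrier G" "h \<in> carrier G" "h \<ominus> g \<in> A" for g h
    using that A minus_diff_eq[of h g] by (metis imageI)
  have asymB: "g \<ominus> h \<notin> B" if "g \<in> carrier G" "h \<in> carrier G" "h \<ominus> g \<in> B" for g h
    using that B minus_diff_eq[of h g] by (metis IntI emptyE imageI)
  show ?thesis
  proof
    show "finite (verts (mixed_cayley G A B))"
      using fin by (simp add: mixed_cayley_def)
  next
    fix e
    assume "e \<in> edges (mixed_cayley G A B)"
    then obtain g h where "e = {g, h}" "g \<in> carrier G" "h \<in> carrier G" "h \<ominus> g \<in> A"
      by (auto simp: mixed_cayley_def)
    then show "\<exists>u v. e = {u, v} \<and> u \<in> verts (mixed_cayley G A B)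
        \<and> v \<in> verts (mixed_cayley G A B) \<and> u \<noteq> v"
      using ne[of g h] by (auto simp: mixed_cayley_def)
  next
    fix u v
    assume uv: "(u, v) \<in> arcs (mixed_cayley G A B)"
    then have uv': "u \<in> carrier G" "v \<in> carrier G" "v \<ominus> u \<in> B"
      by (auto simp: mixed_cayley_def)
    then show "u \<in> verts (mixed_cayley G A B) \<and> v \<in> verts (mixed_cayley G A B) \<and> u \<noteq> v"
      using ne[of u v] by (auto simp: mixed_cayley_def)
    have "v \<ominus> u \<in> A" if "{u, v} \<in> edges (mixed_cayley G A B)"
      using that symA by (auto simp: mixed_cayley_def doubleton_eq_iff)
    then show "(v, u) \<notin> arcs (mixed_cayley G A B) \<and> {u, v} \<notin> edges (mixed_cayley G A B)"
      using uv' asymB[of u v] disj by (auto simp: mixed_cayley_def)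
  qed
qed


section \<open>The actions on the group\<close>

definition group_exponent :: "('g, 'm) ring_scheme \<Rightarrow> nat" where
  "group_exponent G = Lcm (group.ord (add_monoid G) ` carrier G)"

text \<open>The unit group of the integers modulo \<open>t\<close>, represented by the integers in \<open>{0..t - 1}\<close>
  coprime to \<open>t\<close>.\<close>

definition unit_group :: "nat \<Rightarrow> int monoid" where
  "unit_group t = units_of (residue_ring (int t))"

definition unit_group_1_mod_4 :: "nat \<Rightarrow> int monoid" where
  "unit_group_1_mod_4 n =
     (unit_group (4 * n))\<lparr>carrier := {k \<in> carrier (unit_group (4 * n)). [k = 1] (mod 4)}\<rparr>"

definition mult_action :: "('g, 'm) ring_scheme \<Rightarrow> int \<Rightarrow> 'g \<Rightarrow> 'g" where
  "mult_action G k = (\<lambda>x\<in>carrier G. [k] \<cdot>\<^bsub>G\<^esub> x)"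

lemma (in abelian_group) add_pow_group_exponent_mult:
  assumes x: "x \<in> carrier G"
  shows "[(int (group_exponent G) * k)] \<cdot> x = \<zero>"
proof -
  have "add.ord x dvd group_exponent G"
    unfolding group_exponent_def using x by (intro dvd_Lcm) auto
  then have "[group_exponent G] \<cdot> x = \<zero>"
    using add.pow_eq_id[OF x] by blast
  then have "[(int (group_exponent G))] \<cdot> x = \<zero>"
    by (simp add: add_pow_int_ge)
  then show ?thesis
    using add.int_pow_pow[OF x, of k "int (group_exponent G)"] by simp
qed

lemma (in abelian_group) add_pow_mod_group_exponent:
  assumes x: "x \<in> carrier G" and "group_exponent G dvd t"
  shows "[(k mod int t)] \<cdot> x = [k] \<cdot> x"
proof -
  obtain s where s: "t = group_exponent G * s"
    using assms(2) by blast
  have "[k] \<cdot> x = [(int (group_exponent G) * (int s * (k div int t)) + k mod int t)] \<cdot> x"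
    by (simp add: s flip: mult.assoc)
  also have "\<dots> = [(k mod int t)] \<cdot> x"
    using x by (simp add: add.int_pow_mult add_pow_group_exponent_mult)
  finally show ?thesis ..
qed

lemma group_unit_group:
  assumes "t > 1"
  shows "group (unit_group t)"
proof -
  interpret residues "int t" "residue_ring (int t)"
    using assms by unfold_locales auto
  show ?thesis
    unfolding unit_group_def by (rule units_group)
qed

lemma carrier_unit_group:
  assumes "t > 1"
  shows "carrier (unit_group t) = {k. 0 < k \<and> k < int t \<and> coprime k (int t)}"
proof -
  interpret residues "int t" "residue_ring (int t)"
    using assms by unfold_locales auto
  show ?thesis
    by (simp add: unit_group_def units_of_def res_units_eq)
qed

lemma mult_unit_group: "k \<otimes>\<^bsub>unit_group t\<^esub> l = (k * l) mod int t"
  by (simp add: unit_group_def units_of_def residue_ring_def)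

lemma one_unit_group: "\<one>\<^bsub>unit_group t\<^esub> = 1"
  by (simp add: unit_group_def units_of_def residue_ring_def)

lemma (in abelian_group) group_action_unit_group:
  assumes t: "t > 1" "group_exponent G dvd t"
  shows "group_action (unit_group t) (carrier G) (mult_action G)"
proof -
  interpret U: group "unit_group t"
    using t by (intro group_unit_group)
  have comp: "[k] \<cdot> ([l] \<cdot> x) = [(k \<otimes>\<^bsub>unit_group t\<^esub> l)] \<cdot> x" if "x \<in> carrier G" for k l x
    using that t add.int_pow_pow[OF that, of k l]
    by (simp add: mult_unit_group add_pow_mod_group_exponent mult.commute)
  have one: "[(\<one>\<^bsub>unit_group t\<^esub>)] \<cdot> x = x" if "x \<in> carrier G" for x
    using that by (simp add: one_unit_group)
  have inv: "[k] \<cdot> ([(inv\<^bsub>unit_group t\<^esub> k)] \<cdot> x) = x" "[(inv\<^bsub>unit_group t\<^esub> k)] \<cdot> ([k] \<cdot> x) = x"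
    if "k \<in> carrier (unit_group t)" "x \<in> carrier G" for k x
    using that by (simp_all add: comp one)
  have bij: "mult_action G k \<in> carrier (BijGroup (carrier G))" if "k \<in> carrier (unit_group t)" for k
  proof -
    have "bij_betw (\<lambda>x. [k] \<cdot> x) (carrier G) (carrier G)"
      by (rule bij_betw_byWitness[where f' = "\<lambda>x. [(inv\<^bsub>unit_group t\<^esub> k)] \<cdot> x"]) (use that inv in auto)
    then show ?thesis
      by (auto simp: BijGroup_def Bij_def mult_action_def intro: bij_betw_cong[THEN iffD1, rotated])
  qed
  show ?thesis
  proof (intro group_action.intro group_hom.intro group_hom_axioms.intro homI)
    fix k l
    assume kl: "k \<in> carrier (unit_group t)" "l \<in> carrier (unit_group t)"
    have "mult_action G (k \<otimes>\<^bsub>unit_group t\<^esub> l)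
        = compose (carrier G) (mult_action G k) (mult_action G l)"
      by (rule ext) (auto simp: mult_action_def compose_def comp)
    then show "mult_action G (k \<otimes>\<^bsub>unit_group t\<^esub> l)
        = mult_action G k \<otimes>\<^bsub>BijGroup (carrier G)\<^esub> mult_action G l"
      using bij[OF kl(1)] bij[OF kl(2)] by (simp add: BijGroup_def)
  qed (use bij group_BijGroup U.is_group in auto)
qed

lemma subgroup_unit_group_1_mod_4:
  assumes "n > 0"
  shows "subgroup (carrier (unit_group_1_mod_4 n)) (unit_group (4 * n))"
proof -
  interpret U: group "unit_group (4 * n)"
    using assms by (intro group_unit_group) auto
  have mod4: "(k \<otimes>\<^bsub>unit_group (4 * n)\<^esub> l) mod 4 = (k * l) mod 4" for k l
    by (simp add: mult_unit_group mod_mod_cancel)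
  show ?thesis
  proof (rule U.subgroupI)
    show "carrier (unit_group_1_mod_4 n) \<subseteq> carrier (unit_group (4 * n))"
      by (auto simp: unit_group_1_mod_4_def)
    show "carrier (unit_group_1_mod_4 n) \<noteq> {}"
      using U.one_closed by (auto simp: unit_group_1_mod_4_def one_unit_group)
  next
    fix k
    assume "k \<in> carrier (unit_group_1_mod_4 n)"
    then have k: "k \<in> carrier (unit_group (4 * n))" "[k = 1] (mod 4)"
      by (auto simp: unit_group_1_mod_4_def)
    let ?i = "inv\<^bsub>unit_group (4 * n)\<^esub> k"
    have "(k * ?i) mod 4 = 1"
      using U.r_inv[OF k(1)] mod4[of k ?i] by (simp add: one_unit_group)
    moreover have "(k * ?i) mod 4 = ?i mod 4"
      using cong_scalar_right[OF k(2), of ?i] by (simp add: cong_def)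
    ultimately show "?i \<in> carrier (unit_group_1_mod_4 n)"
      using k U.inv_closed by (auto simp: unit_group_1_mod_4_def cong_def)
  next
    fix k l
    assume "k \<in> carrier (unit_group_1_mod_4 n)" "l \<in> carrier (unit_group_1_mod_4 n)"
    then show "k \<otimes>\<^bsub>unit_group (4 * n)\<^esub> l \<in> carrier (unit_group_1_mod_4 n)"
      using cong_mult[of k 1 4 l 1] by (auto simp: unit_group_1_mod_4_def cong_def mod4)
  qed
qed

end

theory Submission
  imports Defs "HOL-Computational_Algebra.Polynomial" "HOL-Number_Theory.Totient"
    "HOL-Library.FuncSet"
begin

text \<open>The Hermitian adjacency matrix of \<open>Cay(G, A \<union> B)\<close> has entries \<open>w (v - u)\<close>, where the weight
  \<open>w\<close> is \<open>1\<close> on \<open>A\<close>, \<open>\<i>\<close> on \<open>B\<close>, \<open>- \<i>\<close> on \<open>- B\<close> and \<open>0\<close> elsewhere.  Translations commute with it, so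
  every eigenspace contains a character of \<open>G\<close>, and the eigenvalues are exactly the sums
  \<open>f \<chi> = (\<Sum>g. w g * \<chi> g)\<close> (lemma \<open>hermitian_eigenvalue_iff_fourier\<close>).

  Let \<open>n\<close> be the exponent of \<open>G\<close>.  Everything turns on the condition
    \<open>w (k g) = (w g) ^ k\<close> for all \<open>g\<close> and all \<open>k\<close> coprime to \<open>4 n\<close>.
  If \<open>k \<equiv> 1 (mod 4)\<close>, then \<open>(w g) ^ k = w g\<close>, and the condition says that \<open>k\<close> preserves \<open>A\<close>, \<open>B\<close> and
  \<open>- B\<close>.  For \<open>k \<equiv> 3 (mod 4)\<close> it follows from the case of \<open>- k\<close>, since \<open>w (- g)\<close> is the conjugate of
  \<open>w g\<close>.  Hence it is equivalent to the invariance of \<open>A\<close> under all units and of \<open>B\<close> under the units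
  that are \<open>1\<close> modulo \<open>4\<close>, and a set is invariant under an action iff it is a union of orbits.

  In terms of the cyclotomic field of order \<open>4 n\<close>, the condition says that the automorphisms
  \<open>\<zeta> \<mapsto> \<zeta> ^ k\<close> fix all eigenvalues.  Its equivalence with integrality has an elementary proof that
  avoids Galois theory.

  If the condition holds, then replacing each term \<open>z = w g * \<chi> g\<close> of an eigenvalue \<open>\<lambda>\<close> by \<open>z ^ k\<close> only
  permutes the terms.  Summing the \<open>r\<close>-th powers of these expressions over all \<open>k\<close> coprime to \<open>4 n\<close>
  shows that \<open>totient (4 n) * \<lambda> ^ r\<close> is a sum of Ramanujan sums, hence an integer.  As this holds for
  every \<open>r\<close>, the powers of \<open>\<lambda>\<close> have a common denominator, and \<open>\<lambda>\<close> is an integer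
  (\<open>fourier_in_Ints\<close>).

  Conversely, let all eigenvalues be integers, and let \<open>p\<close> be a prime above \<open>2 |G|\<close>.  Work in the
  group ring of \<open>G\<close> over the Gaussian integers, its elements read as functions of the character
  \<open>\<chi>\<close>.  All values of \<open>f\<close> are integers of absolute value at most \<open>|G|\<close>, and these are distinct
  modulo \<open>p\<close>; therefore \<open>x ^ p - x\<close> is, modulo \<open>p\<close>, a multiple of a polynomial that vanishes at all of
  them, and \<open>f ^ p \<equiv> f\<close> modulo \<open>p\<close> times the group ring.  The Frobenius congruence, on the other hand,
  gives \<open>f \<chi> ^ p \<equiv> (\<Sum>g. (w g) ^ p * \<chi> (p g))\<close>.  Comparing coefficients, \<open>w (p g)\<close> and \<open>(w g) ^ p\<close>
  are congruent modulo \<open>p\<close>, and they are too small to be different (\<open>weight_add_pow_prime\<close>).  Every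
  \<open>k\<close> coprime to \<open>4 n\<close> is congruent modulo \<open>4 n\<close> to a product of such large primes.\<close>

section \<open>Congruences modulo a prime\<close>

text \<open>A polynomial over a field that vanishes at given distinct points is divisible by the product of
  the corresponding linear factors; here the field is that of the integers modulo \<open>p\<close>.\<close>

lemma int_poly_eq_prod_roots_mod_prime:
  fixes f :: "int poly" and p :: int
  assumes "finite X" "prime p" "\<And>a. a \<in> X \<Longrightarrow> p dvd poly f a"
    and "\<And>a b. a \<in> X \<Longrightarrow> b \<in> X \<Longrightarrow> p dvd a - b \<Longrightarrow> a = b"
  shows "\<exists>q r. f = (\<Prod>a\<in>X. [:- a, 1:]) * q + smult p r"
  using assms(1,3,4)
proof (induction X arbitrary: f rule: finite_induct)
  case empty
  have "f = (\<Prod>a\<in>{}. [:- a, 1:]) * f + smult p 0"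
    by simp
  then show ?case by blast
next
  case (insert a X)
  define g where "g = synthetic_div f a"
  have f: "f = [:- a, 1:] * g + [:poly f a:]"
    using synthetic_div_correct'[of a f] by (simp add: g_def)
  have dvd_a: "p dvd poly f a"
    using insert.prems(1) by simp
  have "p dvd poly g b" if "b \<in> X" for b
  proof -
    have "poly f b = (b - a) * poly g b + poly f a"
      by (subst f) (simp add: algebra_simps)
    moreover have "p dvd poly f b"
      using insert.prems(1) that by simp
    ultimately have "p dvd (b - a) * poly g b"
      using dvd_a by (metis dvd_add_left_iff)
    moreover have "\<not> p dvd b - a"
      using insert.prems(2)[of b a] insert.hyps that by auto
    ultimately show ?thesis
      using prime_dvd_multD[OF assms(2)] by blast
  qed
  then obtain q r where g: "g = (\<Prod>a\<in>X. [:- a, 1:]) * q + smult p r"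
    using insert.IH insert.prems(2) by (metis insertCI)
  obtain c where c: "poly f a = p * c"
    using dvd_a by blast
  have "f = (\<Prod>a\<in>insert a X. [:- a, 1:]) * q + smult p ([:- a, 1:] * r + [:c:])"
  proof -
    have "[:poly f a:] = smult p [:c:]"
      by (simp add: c)
    then show ?thesis
      using insert.hyps
      by (subst f) (simp add: g ring_distribs smult_add_right mult.assoc del: mult_pCons_left)
  qed
  then show ?case by blast
qed

lemma prime_dvd_power_diff_int:
  fixes a :: int
  assumes "prime p"
  shows "int p dvd a ^ p - a"
proof -
  define b where "b = nat (a mod int p)"
  have p: "p > 0" using assms prime_gt_0_nat by blast
  have b: "int b = a mod int p"
    using p by (simp add: b_def)
  have "[b ^ p = b] (mod p)"
  proof (cases "p dvd b")
    case True
    then show ?thesis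
      using p by (metis cong_0_iff cong_sym cong_trans dvd_power dvd_trans)
  next
    case False
    then have "[b ^ (p - 1) * b = 1 * b] (mod p)"
      using fermat_theorem[OF assms] by (intro cong_mult) auto
    then show ?thesis
      by (simp only: power_minus_mult[OF p] mult_1)
  qed
  then have "[int b ^ p = int b] (mod int p)"
    by (metis cong_int_iff of_nat_power)
  moreover have "[int b = a] (mod int p)"
    by (simp add: b)
  ultimately have "[a ^ p = a] (mod int p)"
    by (meson cong_pow cong_sym cong_trans)
  then show ?thesis
    by (simp add: cong_iff_dvd_diff)
qed

text \<open>Modulo a large \<open>p\<close> the polynomial \<open>x ^ p - x\<close> lies in the ideal of the product of all \<open>x - a\<close> with
  \<open>\<bar>a\<bar> \<le> N\<close>.  The point is that \<open>(a ^ p - a) / p\<close> is the value of one and the same integral polynomial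
  \<open>r\<close> at all these \<open>a\<close>, so that it can be formed inside a ring that does not allow division by \<open>p\<close>.\<close>

lemma integer_power_diff_eq_prime_mult:
  assumes "prime p" "p > 2 * N"
  obtains r :: "int poly" where
    "\<And>a. \<bar>a\<bar> \<le> int N \<Longrightarrow> a ^ p - a = int p * poly r a"
proof -
  let ?f = "Polynomial.monom 1 p - Polynomial.monom 1 1 :: int poly"
  have "a = b" if "a \<in> {- int N..int N}" "b \<in> {- int N..int N}" "int p dvd a - b" for a b
  proof (rule ccontr)
    assume "a \<noteq> b"
    then have "\<bar>int p\<bar> \<le> \<bar>a - b\<bar>"
      using that(3) by (intro dvd_imp_le_int) auto
    then show False
      using that(1,2) assms(2) by auto
  qed
  then obtain q r where qr: "?f = (\<Prod>a\<in>{- int N..int N}. [:- a, 1:]) * q + smult (int p) r"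
    using int_poly_eq_prod_roots_mod_prime[of "{- int N..int N}" "int p" ?f]
      prime_dvd_power_diff_int[OF assms(1)] assms(1) by (auto simp: poly_monom)
  have "a ^ p - a = int p * poly r a" if "\<bar>a\<bar> \<le> int N" for a
  proof -
    have "(\<Prod>b\<in>{- int N..int N}. a - b) = 0"
      using that by (intro prod_zero) auto
    moreover have "poly ?f a = (\<Prod>b\<in>{- int N..int N}. a - b) * poly q a + int p * poly r a"
      unfolding qr by (simp add: poly_prod)
    ultimately show ?thesis
      by (simp add: poly_monom)
  qed
  then show ?thesis by (rule that)
qed

lemma prime_power_add_expansion:
  fixes a b :: complex
  assumes "prime p"
  shows "(a + b) ^ p - a ^ p - b ^ p
           = of_nat p * (\<Sum>k\<in>{0<..<p}. of_int (int ((p choose k) div p)) * (a ^ k * b ^ (p - k)))"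
proof -
  have p: "p > 0" using assms prime_gt_0_nat by blast
  have "(a + b) ^ p = (\<Sum>k\<le>p. of_nat (p choose k) * a ^ k * b ^ (p - k))"
    by (rule binomial_ring)
  also have "{..p} = insert 0 (insert p {0<..<p})"
    using p by auto
  also have "(\<Sum>k\<in>\<dots>. of_nat (p choose k) * a ^ k * b ^ (p - k))
      = b ^ p + (a ^ p + (\<Sum>k\<in>{0<..<p}. of_nat (p choose k) * a ^ k * b ^ (p - k)))"
    using p by (subst sum.insert; simp)+
  also have "(\<Sum>k\<in>{0<..<p}. of_nat (p choose k) * a ^ k * b ^ (p - k))
      = of_nat p * (\<Sum>k\<in>{0<..<p}. of_int (int ((p choose k) div p)) * (a ^ k * b ^ (p - k)))"
    unfolding sum_distrib_left
  proof (intro sum.cong refl)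
    fix k assume "k \<in> {0<..<p}"
    then have "p dvd p choose k"
      using assms by (intro dvd_choose_prime) auto
    then have "of_nat (p choose k) = (of_nat p * of_nat ((p choose k) div p) :: complex)"
      by (metis dvd_mult_div_cancel of_nat_mult)
    then show "of_nat (p choose k) * a ^ k * b ^ (p - k)
        = of_nat p * (of_int (int ((p choose k) div p)) * (a ^ k * b ^ (p - k)))"
      by simp
  qed
  finally show ?thesis by simp
qed

section \<open>Residue classes and their prime factors\<close>

text \<open>The summand \<open>m * t\<close> destroys every small prime factor: a prime \<open>q \<le> L\<close> divides exactly one of \<open>k\<close>
  and \<open>m * t\<close>.  This elementary replacement for Dirichlet's theorem suffices for identities that are
  multiplicative in \<open>k\<close>.\<close>

lemma cong_with_large_prime_factors:
  fixes k m L :: nat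
  assumes "coprime k m" "k > 0"
  obtains k' where "[k' = k] (mod m)" "coprime k' m" "k' > 0" "\<And>q. prime q \<Longrightarrow> q dvd k' \<Longrightarrow> q > L"
proof
  define t where "t = (\<Prod>{q. prime q \<and> q \<le> L \<and> \<not> q dvd k})"
  have fin: "finite {q. prime q \<and> q \<le> L \<and> \<not> q dvd k}"
    by (rule finite_subset[of _ "{..L}"]) auto
  show "[k + m * t = k] (mod m)"
    by (simp add: cong_def)
  show "coprime (k + m * t) m"
    by (rule cong_imp_coprime[OF _ assms(1)]) (simp add: cong_def)
  show "k + m * t > 0"
    using assms(2) by simp
  fix q :: nat
  assume q: "prime q" "q dvd k + m * t"
  show "q > L"
  proof (rule ccontr)
    assume "\<not> q > L"
    show False
    proof (cases "q dvd k")
      case True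
      then have "q dvd m * t"
        using q(2) by (simp add: dvd_add_right_iff)
      moreover have "\<not> q dvd m"
        using assms(1) True q(1) by (meson coprime_common_divisor not_prime_unit)
      ultimately have "q dvd t"
        using q(1) prime_dvd_multD by blast
      then obtain r where "prime r" "\<not> r dvd k" "q dvd r"
        unfolding t_def using q(1) fin by (auto simp: prime_dvd_prod_iff)
      then show False
        using True q(1) by (metis primes_dvd_imp_eq)
    next
      case False
      then have "q dvd t"
        unfolding t_def using \<open>\<not> q > L\<close> q(1) fin by (intro dvd_prodI[where f = "\<lambda>x. x"]) auto
      then show False
        using False q(2) by (simp add: dvd_add_left_iff)
    qed
  qed
qed

lemma prime_factor_induct:
  fixes m :: nat
  assumes "m > 0" "\<And>q. prime q \<Longrightarrow> q dvd m \<Longrightarrow> Q q" "Q 1"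
    and "\<And>q r. Q q \<Longrightarrow> Q r \<Longrightarrow> Q (q * r)"
  shows "Q m"
  using assms(1,2)
proof (induction m rule: less_induct)
  case (less m)
  show ?case
  proof (cases "m = 1")
    case False
    then obtain q where q: "prime q" "q dvd m"
      using prime_factor_nat by blast
    then obtain r where m: "m = q * r" by blast
    then have "r > 0" "r < m"
      using less.prems(1) prime_gt_1_nat[OF q(1)] by auto
    then have "Q r"
      using less m by auto
    then show ?thesis
      using less.prems(2)[OF q] assms(4) m by simp
  qed (use assms(3) in simp)
qed

lemma coprime_4_mult_imp_cong_1_or_3:
  fixes l m :: nat
  assumes "coprime l (4 * m)"
  shows "[l = 1] (mod 4) \<or> [l = 3] (mod 4)"
proof -
  have "coprime l (2 * (2 * m))"
    using assms by simp
  then have "coprime l 2"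
    by (simp only: coprime_mult_right_iff)
  then have "odd l"
    by simp
  then have "l mod 4 = 1 \<or> l mod 4 = 3"
    by presburger
  then show ?thesis
    by (auto simp: cong_def)
qed

lemma power_cong_mod_4:
  fixes z :: complex
  assumes "z \<in> {0, 1, \<i>, - \<i>}" "[k = l] (mod 4)" "k > 0" "l > 0"
  shows "z ^ k = z ^ l"
proof (cases "z = 0")
  case False
  then have z: "z ^ 4 = 1"
    using assms(1) by (auto simp: power4_eq_xxxx)
  have "z ^ m = z ^ (m mod 4)" for m
  proof -
    have "z ^ m = (z ^ 4) ^ (m div 4) * z ^ (m mod 4)"
      by (simp flip: power_mult power_add)
    then show ?thesis by (simp add: z)
  qed
  then show ?thesis
    using assms(2) by (metis cong_def)
qed (use assms in \<open>simp add: power_0_left\<close>)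

section \<open>Ramanujan sums and integrality\<close>

lemma sum_powers_root_of_unity:
  fixes z :: complex
  assumes "z ^ n = 1"
  shows "(\<Sum>k\<in>{0<..n}. z ^ k) \<in> \<int>"
proof (cases "z = 1")
  case False
  have "(\<Sum>k\<in>{0<..n}. z ^ k) = z * (\<Sum>k<n. z ^ k)"
    by (simp add: sum_distrib_left sum.atLeast1_atMost_eq
        flip: atLeastSucAtMost_greaterThanAtMost power_Suc)
  also have "(\<Sum>k<n. z ^ k) = 0"
    using assms False by (simp add: geometric_sum)
  finally show ?thesis by simp
qed auto

text \<open>Sorting the exponents \<open>1, \<dots>, n\<close> by their greatest common divisor with \<open>n\<close> expresses the full sum,
  which is \<open>0\<close> or \<open>n\<close>, through Ramanujan sums of the divisors of \<open>n\<close>.\<close>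

lemma ramanujan_sum_in_Ints:
  fixes z :: complex
  assumes "z ^ n = 1"
  shows "(\<Sum>k\<in>totatives n. z ^ k) \<in> \<int>"
  using assms
proof (induction n arbitrary: z rule: less_induct)
  case (less n)
  show ?case
  proof (cases "n = 0")
    case False
    define C where "C d = (\<Sum>k | k \<in> {0<..n} \<and> gcd k n = d. z ^ k)" for d
    have C: "C d = (\<Sum>k\<in>totatives (n div d). (z ^ d) ^ k)" if "d dvd n" for d
    proof -
      have "d > 0"
        using False that by (auto intro: Nat.gr0I)
      have "(\<Sum>k\<in>totatives (n div d). z ^ (k * d)) = C d"
        unfolding C_def
        using bij_betw_totatives_gcd_eq[of d n] False that
        by (intro sum.reindex_bij_betw) auto
      then show ?thesis
        by (simp add: mult.commute flip: power_mult)
    qed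
    have "(\<Sum>k\<in>{0<..n}. z ^ k) = (\<Sum>d | d dvd n. C d)"
      unfolding C_def using False
      by (subst sum.group) auto
    also have "\<dots> = C 1 + (\<Sum>d\<in>{d. d dvd n} - {1}. C d)"
      using False by (subst sum.remove[of _ 1]) auto
    also have "C 1 = (\<Sum>k\<in>totatives n. z ^ k)"
      by (simp add: C)
    finally have "(\<Sum>k\<in>totatives n. z ^ k)
        = (\<Sum>k\<in>{0<..n}. z ^ k) - (\<Sum>d\<in>{d. d dvd n} - {1}. C d)"
      by simp
    moreover have "C d \<in> \<int>" if "d \<in> {d. d dvd n} - {1}" for d
    proof -
      have d: "d dvd n" "d \<noteq> 1" "d > 0"
        using that False by (auto intro: Nat.gr0I)
      then have "n div d < n"
        using False by (intro div_less_dividend) auto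
      moreover have "(z ^ d) ^ (n div d) = 1"
        using d less.prems by (simp flip: power_mult)
      ultimately show ?thesis
        using less.IH C[OF d(1)] by simp
    qed
    ultimately show ?thesis
      using sum_powers_root_of_unity[OF less.prems] by auto
  qed auto
qed

text \<open>Each \<open>r\<close>-th power expands into \<open>k\<close>-th powers of \<open>r\<close>-fold products of the \<open>z s\<close>, which are again
  roots of unity, and summation over \<open>k\<close> turns these into Ramanujan sums.\<close>

lemma sum_totatives_power_sum_power_in_Ints:
  fixes z :: "'b \<Rightarrow> complex"
  assumes "finite S" "\<And>s. s \<in> S \<Longrightarrow> z s ^ N = 1"
  shows "(\<Sum>k\<in>totatives N. (\<Sum>s\<in>S. z s ^ k) ^ r) \<in> \<int>"
proof -
  have "(\<Sum>s\<in>S. z s ^ k) ^ r = (\<Sum>f\<in>PiE {..<r} (\<lambda>_. S). (\<Prod>i<r. z (f i)) ^ k)" for k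
  proof -
    have "(\<Sum>s\<in>S. z s ^ k) ^ r = (\<Prod>i<r. \<Sum>s\<in>S. z s ^ k)"
      by simp
    also have "\<dots> = (\<Sum>f\<in>PiE {..<r} (\<lambda>_. S). \<Prod>i<r. z (f i) ^ k)"
      using assms(1) by (intro prod_sum_PiE) auto
    finally show ?thesis
      by (simp add: prod_power_distrib)
  qed
  then have "(\<Sum>k\<in>totatives N. (\<Sum>s\<in>S. z s ^ k) ^ r)
      = (\<Sum>f\<in>PiE {..<r} (\<lambda>_. S). \<Sum>k\<in>totatives N. (\<Prod>i<r. z (f i)) ^ k)"
    by (simp add: sum.swap[of _ _ "totatives N"])
  also have "\<dots> \<in> \<int>"
  proof (rule Ints_sum, rule ramanujan_sum_in_Ints)
    fix f assume f: "f \<in> PiE {..<r} (\<lambda>_. S)"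
    have "(\<Prod>i<r. z (f i)) ^ N = (\<Prod>i<r. z (f i) ^ N)"
      by (rule prod_power_distrib)
    also have "\<dots> = 1"
      using assms(2) f by (intro prod.neutral) auto
    finally show "(\<Prod>i<r. z (f i)) ^ N = 1" .
  qed
  finally show ?thesis .
qed


text \<open>If \<open>x = a / b\<close> in lowest terms, then every power of \<open>b\<close> divides \<open>D\<close>.\<close>

lemma in_Ints_of_bounded_denominators:
  fixes x :: complex
  assumes "D > 0" "\<And>r. of_nat D * x ^ r \<in> \<int>"
  shows "x \<in> \<int>"
proof -
  obtain N where N: "of_nat D * x = of_int N"
    using assms(2)[of 1] by (auto elim: Ints_cases)
  define a b where "a = N div gcd N (int D)" and "b = int D div gcd N (int D)"
  have cop: "coprime a b"
    unfolding a_def b_def using assms(1) by (intro div_gcd_coprime) auto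
  have gcd: "a * gcd N (int D) = N" "b * gcd N (int D) = int D"
    by (simp_all add: a_def b_def)
  have "b > 0"
    using gcd(2) assms(1) by (metis gcd_ge_0_int of_nat_0_less_iff zero_less_mult_pos2 order.order_iff_strict mult_zero_right less_irrefl)
  have "of_int (b * gcd N (int D)) * x = of_int (a * gcd N (int D))"
    unfolding gcd using N by simp
  then have x: "x = of_int a / of_int b"
    using \<open>b > 0\<close> assms(1) by (simp add: field_simps)
  have dvd: "b ^ r dvd int D" for r
  proof -
    obtain M where M: "of_nat D * x ^ r = of_int M"
      using assms(2)[of r] by (auto elim: Ints_cases)
    have "of_int (int D * a ^ r) = (of_int (M * b ^ r) :: complex)"
      using M \<open>b > 0\<close> by (simp add: x field_simps)
    then have "int D * a ^ r = M * b ^ r"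
      using of_int_eq_iff by blast
    then have "b ^ r dvd int D * a ^ r"
      by simp
    moreover have "coprime (b ^ r) (a ^ r)"
      using cop by (simp add: coprime_commute)
    ultimately show ?thesis
      by (simp add: coprime_dvd_mult_left_iff)
  qed
  have "b = 1"
  proof (rule ccontr)
    assume "b \<noteq> 1"
    then have "b \<ge> 2" using \<open>b > 0\<close> by simp
    then have "(2::int) ^ D \<le> b ^ D"
      by (intro power_mono) auto
    moreover have "b ^ D \<le> int D"
      using dvd assms(1) by (intro zdvd_imp_le) auto
    moreover have "int D < 2 ^ D"
      by (metis less_exp of_nat_less_iff of_nat_numeral of_nat_power)
    ultimately show False by linarith
  qed
  then show ?thesis by (simp add: x)
qed


section \<open>Gaussian integers\<close>

definition gaussian_ints :: "complex set" where
  "gaussian_ints = {z. Re z \<in> \<int> \<and> Im z \<in> \<int>}"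

lemma gaussian_ints_intros:
  shows "of_int k \<in> gaussian_ints" "\<i> \<in> gaussian_ints" "0 \<in> gaussian_ints" "1 \<in> gaussian_ints"
    and "y \<in> gaussian_ints \<Longrightarrow> z \<in> gaussian_ints \<Longrightarrow> y + z \<in> gaussian_ints"
    and "y \<in> gaussian_ints \<Longrightarrow> z \<in> gaussian_ints \<Longrightarrow> y * z \<in> gaussian_ints"
    and "z \<in> gaussian_ints \<Longrightarrow> - z \<in> gaussian_ints"
  by (auto simp: gaussian_ints_def)

lemma gaussian_int_eq_0:
  assumes "z \<in> gaussian_ints" "norm z < 1"
  shows "z = 0"
proof -
  have "\<bar>Re z\<bar> < 1" "\<bar>Im z\<bar> < 1"
    using abs_Re_le_cmod[of z] abs_Im_le_cmod[of z] assms(2) by linarith+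
  then show ?thesis
    using assms(1) by (auto simp: gaussian_ints_def complex_eq_iff elim!: Ints_cases)
qed

section \<open>Invariant sets of a group action\<close>

lemma (in group_action) invariant_iff_union_of_orbits:
  assumes "X \<subseteq> E"
  shows "(\<forall>g\<in>carrier G. \<phi> g ` X = X) \<longleftrightarrow> (\<exists>\<O>\<subseteq>orbits G E \<phi>. X = \<Union>\<O>)"
proof
  assume inv: "\<forall>g\<in>carrier G. \<phi> g ` X = X"
  have "X = \<Union>(orbit G \<phi> ` X)"
  proof
    show "X \<subseteq> \<Union>(orbit G \<phi> ` X)"
      using orbit_refl assms by blast
    show "\<Union>(orbit G \<phi> ` X) \<subseteq> X"
      using inv by (auto simp: orbit_def)
  qed
  moreover have "orbit G \<phi> ` X \<subseteq> orbits G E \<phi>"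
    using assms by (auto simp: orbits_def)
  ultimately show "\<exists>\<O>\<subseteq>orbits G E \<phi>. X = \<Union>\<O>"
    by blast
next
  assume "\<exists>\<O>\<subseteq>orbits G E \<phi>. X = \<Union>\<O>"
  then obtain \<O> where \<O>: "\<O> \<subseteq> orbits G E \<phi>" "X = \<Union>\<O>" by blast
  interpret group G
    using group_hom group_hom.axioms(1) by auto
  have closed: "\<phi> g x \<in> X" if g: "g \<in> carrier G" and x: "x \<in> X" for g x
  proof -
    obtain O' where O': "O' \<in> \<O>" "x \<in> O'"
      using x \<O>(2) by blast
    then obtain y where y: "y \<in> E" "x \<in> orbit G \<phi> y" "orbit G \<phi> y \<subseteq> X"
      using \<O> unfolding orbits_def by blast
    from y(2) obtain h where h: "h \<in> carrier G" "x = \<phi> h y"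
      by (auto simp: orbit_def)
    then have "\<phi> g x = \<phi> (g \<otimes> h) y"
      using composition_rule[OF y(1) g] by simp
    then have "\<phi> g x \<in> orbit G \<phi> y"
      using g h(1) by (auto simp: orbit_def)
    then show ?thesis using y(3) by blast
  qed
  show "\<forall>g\<in>carrier G. \<phi> g ` X = X"
  proof
    fix g assume g: "g \<in> carrier G"
    have "x \<in> \<phi> g ` X" if "x \<in> X" for x
    proof
      show "\<phi> (inv g) x \<in> X"
        using closed g that by simp
      show "x = \<phi> g (\<phi> (inv g) x)"
        using orbit_sym_aux[OF _ _ refl, of "inv g" x] g that assms by auto
    qed
    then show "\<phi> g ` X = X"
      using closed[OF g] by blast
  qed
qed

section \<open>Characters of a finite abelian group\<close>

locale finite_abelian_group = abelian_group G for G (structure) +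
  assumes finite_carrier: "finite (carrier G)"
begin

definition is_character :: "('a \<Rightarrow> complex) \<Rightarrow> bool" where
  "is_character \<chi> \<longleftrightarrow> \<chi> \<zero> = 1 \<and> (\<forall>g\<in>carrier G. \<forall>h\<in>carrier G. \<chi> (g \<oplus> h) = \<chi> g * \<chi> h)"

lemma group_exponent_pos: "group_exponent G > 0"
proof -
  have "add.ord g \<noteq> 0" if "g \<in> carrier G" for g
    using add.ord_ge_1[OF _ that] finite_carrier by simp
  then have "group_exponent G \<noteq> 0"
    unfolding group_exponent_def using finite_carrier by (subst Lcm_0_iff) (auto simp del: neq0_conv)
  then show ?thesis by simp
qed

lemma add_pow_group_exponent:
  assumes "g \<in> carrier G"
  shows "[group_exponent G] \<cdot> g = \<zero>"
  using add_pow_group_exponent_mult[OF assms, of 1] by (simp add: add_pow_int_ge)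

lemma add_pow_cong_group_exponent:
  assumes "g \<in> carrier G" "[k = l] (mod group_exponent G)"
  shows "[k] \<cdot> g = [l] \<cdot> g"
proof -
  have "[(int k mod int (group_exponent G))] \<cdot> g = [(int l mod int (group_exponent G))] \<cdot> g"
    using assms(2) by (metis cong_def zmod_int)
  then show ?thesis
    using assms(1) by (simp add: add_pow_mod_group_exponent add_pow_int_ge)
qed

lemma exists_inverse_add_pow:
  assumes "coprime k (group_exponent G)"
  obtains l :: nat where "\<And>g. g \<in> carrier G \<Longrightarrow> [k] \<cdot> ([l] \<cdot> g) = g"
    and "\<And>g. g \<in> carrier G \<Longrightarrow> [l] \<cdot> ([k] \<cdot> g) = g"
proof -
  obtain l where l: "[k * l = 1] (mod group_exponent G)"
    using assms cong_solve_coprime_nat by auto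
  have "[k] \<cdot> ([l] \<cdot> g) = g" "[l] \<cdot> ([k] \<cdot> g) = g" if "g \<in> carrier G" for g
    using add_pow_cong_group_exponent[OF that l] that
    by (simp_all add: add.nat_pow_pow mult.commute)
  then show ?thesis by (rule that)
qed

lemma bij_betw_add_pow:
  assumes "coprime (k::nat) (group_exponent G)"
  shows "bij_betw (\<lambda>g. [k] \<cdot> g) (carrier G) (carrier G)"
proof -
  obtain l :: nat where "\<And>g. g \<in> carrier G \<Longrightarrow> [k] \<cdot> ([l] \<cdot> g) = g"
    and "\<And>g. g \<in> carrier G \<Longrightarrow> [l] \<cdot> ([k] \<cdot> g) = g"
    using exists_inverse_add_pow[OF assms] by blast
  then show ?thesis
    by (intro bij_betw_byWitness[where f' = "\<lambda>g. [l] \<cdot> g"]) auto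
qed

lemma
  assumes "is_character \<chi>"
  shows character_zero: "\<chi> \<zero> = 1"
    and character_add: "g \<in> carrier G \<Longrightarrow> h \<in> carrier G \<Longrightarrow> \<chi> (g \<oplus> h) = \<chi> g * \<chi> h"
  using assms by (auto simp: is_character_def)

lemma character_add_pow:
  assumes "is_character \<chi>" "g \<in> carrier G"
  shows "\<chi> ([(k::nat)] \<cdot> g) = \<chi> g ^ k"
  by (induction k) (use assms in \<open>auto simp: character_zero character_add add.nat_pow_Suc\<close>)

lemma character_power_group_exponent:
  assumes "is_character \<chi>" "g \<in> carrier G"
  shows "\<chi> g ^ group_exponent G = 1"
  using character_add_pow[OF assms, of "group_exponent G"] assms
  by (simp add: add_pow_group_exponent character_zero)

lemma norm_character:
  assumes "is_character \<chi>" "g \<in> carrier G"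
  shows "norm (\<chi> g) = 1"
proof -
  have "norm (\<chi> g) ^ group_exponent G = 1"
    using character_power_group_exponent[OF assms] by (metis norm_one norm_power)
  then show ?thesis
    using group_exponent_pos by (metis norm_ge_zero power_eq_1_iff abs_norm_cancel real_norm_def not_gr_zero)
qed

lemma character_mult_cnj:
  assumes "is_character \<chi>" "g \<in> carrier G"
  shows "\<chi> g * cnj (\<chi> g) = 1"
  using norm_character[OF assms] by (simp flip: complex_norm_square)

lemma is_character_cnj:
  assumes "is_character \<chi>"
  shows "is_character (\<lambda>g. cnj (\<chi> g))"
  using assms by (simp add: is_character_def)

lemma bij_betw_add_right:
  assumes "h \<in> carrier G"
  shows "bij_betw (\<lambda>g. g \<oplus> h) (carrier G) (carrier G)"
  by (rule bij_betw_byWitness[where f' = "\<lambda>g. g \<ominus> h"])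
     (use assms in \<open>auto simp: a_minus_def a_assoc r_neg l_neg\<close>)

text \<open>The members are functions on the whole type, but two members that agree on the carrier stand for
  the same vector.\<close>

definition translation_invariant_subspace :: "('a \<Rightarrow> complex) set \<Rightarrow> bool" where
  "translation_invariant_subspace V \<longleftrightarrow>
     (\<forall>u\<in>V. \<forall>v\<in>V. \<forall>c. (\<lambda>g. u g + c * v g) \<in> V) \<and>
     (\<forall>v\<in>V. \<forall>h\<in>carrier G. (\<lambda>g. v (g \<oplus> h)) \<in> V)"

lemma
  assumes "translation_invariant_subspace V"
  shows subspace_add_mult: "u \<in> V \<Longrightarrow> v \<in> V \<Longrightarrow> (\<lambda>g. u g + c * v g) \<in> V"
    and subspace_translate: "v \<in> V \<Longrightarrow> h \<in> carrier G \<Longrightarrow> (\<lambda>g. v (g \<oplus> h)) \<in> V"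
  using assms by (auto simp: translation_invariant_subspace_def)

lemma subspace_mult:
  assumes "translation_invariant_subspace V" "v \<in> V"
  shows "(\<lambda>g. c * v g) \<in> V"
  using subspace_add_mult[OF assms(1,2,2), of "c - 1"] by (simp add: algebra_simps)

lemma subspace_sum:
  assumes V: "translation_invariant_subspace V" "v \<in> V"
    and "finite J" "\<And>j. j \<in> J \<Longrightarrow> f j \<in> V"
  shows "(\<lambda>g. \<Sum>j\<in>J. c j * f j g) \<in> V"
  using assms(3,4)
proof (induction J rule: finite_induct)
  case empty
  show ?case using subspace_mult[OF V, of 0] by simp
next
  case (insert j J)
  have "(\<lambda>g. (\<Sum>j\<in>J. c j * f j g) + c j * f j g) \<in> V"
    using insert by (intro subspace_add_mult[OF V(1)]) auto
  then show ?case
    using insert.hyps by (simp add: add.commute)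
qed

definition translation_eigenvector :: "('a \<Rightarrow> complex) \<Rightarrow> 'a \<Rightarrow> bool" where
  "translation_eigenvector v h \<longleftrightarrow> (\<exists>c. \<forall>g\<in>carrier G. v (g \<oplus> h) = c * v g)"

text \<open>If \<open>n\<close> is the exponent, then the \<open>n\<close>-th power of the translation by \<open>h\<close> is the identity, so
  averaging \<open>v\<close> against the powers of an \<open>n\<close>-th root of unity \<open>z\<close> yields an eigenvector or zero.
  The averages cannot all vanish at \<open>u\<close>, since otherwise a nonzero polynomial of degree below \<open>n\<close>
  would have \<open>n\<close> roots.  Translations commute, hence the eigenvector properties that \<open>v\<close> already has
  are kept, and one \<open>h\<close> can be treated after the other.\<close>

lemma exists_translation_eigenvector:
  assumes V: "translation_invariant_subspace V" "v \<in> V"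
    and u: "u \<in> carrier G" "v u \<noteq> 0" and h: "h \<in> carrier G"
  shows "\<exists>v'\<in>V. v' u \<noteq> 0 \<and> translation_eigenvector v' h \<and>
           (\<forall>k\<in>carrier G. translation_eigenvector v k \<longrightarrow> translation_eigenvector v' k)"
proof -
  define n where "n = group_exponent G"
  have n: "n > 0"
    using group_exponent_pos by (simp add: n_def)
  \<comment> \<open>Up to the factor \<open>n\<close>, \<open>proj z\<close> is the projection to the eigenvalue \<open>1 / z\<close>.\<close>
  define proj where "proj z g = (\<Sum>j<n. z ^ j * v (g \<oplus> [j] \<cdot> h))" for z g
  have proj_V: "proj z \<in> V" for z
    unfolding proj_def
    by (rule subspace_sum[OF V, where f = "\<lambda>j g. v (g \<oplus> [j] \<cdot> h)"])
       (use V h subspace_translate in auto)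
  have eigen: "proj z (g \<oplus> h) = inverse z * proj z g" if z: "z ^ n = 1" and g: "g \<in> carrier G" for z g
  proof -
    have shift: "(\<Sum>j<m. F (Suc j)) = (\<Sum>j<m. F j) + F m - F 0" for F :: "nat \<Rightarrow> complex" and m
      by (induction m) auto
    let ?f = "\<lambda>j. z ^ j * v (g \<oplus> [j] \<cdot> h)"
    have z0: "z \<noteq> 0" using z n by (auto simp: power_0_left)
    have "z * proj z (g \<oplus> h) = (\<Sum>j<n. ?f (Suc j))"
    proof -
      have "(g \<oplus> h) \<oplus> [j] \<cdot> h = g \<oplus> [(Suc j)] \<cdot> h" for j
        using g h by (simp add: a_ac add.nat_pow_Suc)
      then have "?f (Suc j) = z * (z ^ j * v ((g \<oplus> h) \<oplus> [j] \<cdot> h))" for j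
        by simp
      then show ?thesis
        unfolding proj_def by (simp only: sum_distrib_left)
    qed
    also have "\<dots> = (\<Sum>j<n. ?f j) + ?f n - ?f 0"
      by (rule shift)
    also have "\<dots> = proj z g"
      using z g h by (simp add: proj_def n_def add_pow_group_exponent)
    finally show ?thesis
      using z0 by (simp add: field_simps)
  qed
  have "\<exists>z. z ^ n = 1 \<and> proj z u \<noteq> 0"
  proof (rule ccontr)
    assume "\<not> ?thesis"
    then have zero: "proj z u = 0" if "z ^ n = 1" for z
      using that by blast
    define P where "P = (\<Sum>j<n. Polynomial.monom (v (u \<oplus> [j] \<cdot> h)) j)"
    have coeff: "poly.coeff P j = (if j < n then v (u \<oplus> [j] \<cdot> h) else 0)" for j
      by (simp add: P_def coeff_sum)
    have "poly.coeff P 0 \<noteq> 0"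
      using u n by (simp add: coeff)
    then have P: "P \<noteq> 0" by auto
    have "poly P z = proj z u" for z
      by (simp add: P_def proj_def poly_sum poly_monom mult.commute)
    then have "{z. z ^ n = 1} \<subseteq> {z. poly P z = 0}"
      using zero by auto
    then have "card {z::complex. z ^ n = 1} \<le> card {z. poly P z = 0}"
      using P by (intro card_mono poly_roots_finite) auto
    also have "\<dots> \<le> Polynomial.degree P"
      using P by (rule card_poly_roots_bound)
    also have "\<dots> < n"
    proof -
      have "Polynomial.degree P \<le> n - 1"
        using n by (intro degree_le) (auto simp: coeff)
      then show ?thesis using n by linarith
    qed
    finally show False
      using card_roots_unity_eq[OF n] by simp
  qed
  then obtain z where z: "z ^ n = 1" "proj z u \<noteq> 0" by blast
  have "translation_eigenvector (proj z) k"
    if k: "k \<in> carrier G" and v: "translation_eigenvector v k" for k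
  proof -
    obtain d where d: "\<And>g. g \<in> carrier G \<Longrightarrow> v (g \<oplus> k) = d * v g"
      using v by (auto simp: translation_eigenvector_def)
    have "v (g \<oplus> k \<oplus> [j] \<cdot> h) = d * v (g \<oplus> [j] \<cdot> h)" if g: "g \<in> carrier G" for g and j :: nat
    proof -
      have "g \<oplus> k \<oplus> [j] \<cdot> h = (g \<oplus> [j] \<cdot> h) \<oplus> k"
        using g h k by (simp add: a_ac)
      then show ?thesis using d g h by simp
    qed
    then have "proj z (g \<oplus> k) = d * proj z g" if "g \<in> carrier G" for g
      using that by (simp add: proj_def sum_distrib_left mult.left_commute)
    then show ?thesis
      unfolding translation_eigenvector_def by blast
  qed
  moreover have "translation_eigenvector (proj z) h"
    unfolding translation_eigenvector_def using eigen[OF z(1)] by blast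
  ultimately show ?thesis
    using proj_V z(2) by blast
qed

text \<open>A common eigenvector of all translations is a multiple of a character: its value at \<open>h\<close> is the
  eigenvalue of translation by \<open>h\<close> times its value at \<open>\<zero>\<close>.\<close>

lemma subspace_contains_character:
  assumes V: "translation_invariant_subspace V" "v \<in> V"
    and u: "u \<in> carrier G" "v u \<noteq> 0"
  obtains \<chi> where "\<chi> \<in> V" "is_character \<chi>"
proof -
  have "\<exists>v\<in>V. v u \<noteq> 0 \<and> (\<forall>h\<in>T. translation_eigenvector v h)"
    if "finite T" "T \<subseteq> carrier G" for T
    using that
  proof (induction T rule: finite_induct)
    case empty
    then show ?case using V u by blast
  next
    case (insert h T)
    then obtain v where v: "v \<in> V" "v u \<noteq> 0" and T: "\<forall>h\<in>T. translation_eigenvector v h"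
      by blast
    have h: "h \<in> carrier G" using insert.prems by blast
    obtain v' where "v' \<in> V" "v' u \<noteq> 0" "translation_eigenvector v' h"
      "\<forall>k\<in>carrier G. translation_eigenvector v k \<longrightarrow> translation_eigenvector v' k"
      using exists_translation_eigenvector[OF V(1) v(1) u(1) v(2) h] by blast
    then show ?case
      using T insert.prems by blast
  qed
  from this[OF finite_carrier order_refl] obtain v where v: "v \<in> V" "v u \<noteq> 0"
    and "\<forall>h\<in>carrier G. translation_eigenvector v h"
    by blast
  then have "\<forall>h\<in>carrier G. \<exists>c. \<forall>g\<in>carrier G. v (g \<oplus> h) = c * v g"
    by (simp add: translation_eigenvector_def)
  from bchoice[OF this] obtain c
    where c: "\<forall>h\<in>carrier G. \<forall>g\<in>carrier G. v (g \<oplus> h) = c h * v g" ..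
  have v_c: "v h = c h * v \<zero>" if "h \<in> carrier G" for h
    using bspec[OF bspec[OF c that], of \<zero>] that by simp
  have "v \<zero> \<noteq> 0"
    using v(2) v_c[OF u(1)] by auto
  define \<chi> where "\<chi> = (\<lambda>g. inverse (v \<zero>) * v g)"
  have "\<chi> \<in> V"
    unfolding \<chi>_def using V(1) v(1) by (rule subspace_mult)
  moreover have "is_character \<chi>"
    unfolding is_character_def
  proof (intro conjI ballI)
    show "\<chi> \<zero> = 1"
      using \<open>v \<zero> \<noteq> 0\<close> by (simp add: \<chi>_def)
    fix g h assume gh: "g \<in> carrier G" "h \<in> carrier G"
    have "\<chi> h = c h"
      using v_c[OF gh(2)] \<open>v \<zero> \<noteq> 0\<close> by (simp add: \<chi>_def)
    moreover have "v (g \<oplus> h) = c h * v g"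
      using c gh by blast
    ultimately show "\<chi> (g \<oplus> h) = \<chi> g * \<chi> h"
      by (simp add: \<chi>_def)
  qed
  ultimately show ?thesis by (rule that)
qed

text \<open>The functions orthogonal to all characters form a translation-invariant subspace.  If it were
  nonzero, it would contain a character, which is not orthogonal to its own conjugate.\<close>

lemma characters_complete:
  assumes "\<And>\<chi>. is_character \<chi> \<Longrightarrow> (\<Sum>g\<in>carrier G. v g * \<chi> g) = 0"
    and "u \<in> carrier G"
  shows "v u = 0"
proof (rule ccontr)
  assume "v u \<noteq> 0"
  define V where "V = {v. \<forall>\<chi>. is_character \<chi> \<longrightarrow> (\<Sum>g\<in>carrier G. v g * \<chi> g) = 0}"
  have "translation_invariant_subspace V"
    unfolding translation_invariant_subspace_def
  proof (intro conjI ballI allI)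
    fix u v c assume "u \<in> V" "v \<in> V"
    then show "(\<lambda>g. u g + c * v g) \<in> V"
      by (simp add: V_def ring_distribs sum.distrib mult.assoc flip: sum_distrib_left)
  next
    fix v h assume v: "v \<in> V" and h: "h \<in> carrier G"
    have "(\<Sum>g\<in>carrier G. v (g \<oplus> h) * \<chi> g) = 0" if "is_character \<chi>" for \<chi>
    proof -
      have "\<chi> g = cnj (\<chi> h) * \<chi> (g \<oplus> h)" if "g \<in> carrier G" for g
      proof -
        have "cnj (\<chi> h) * \<chi> (g \<oplus> h) = \<chi> g * (\<chi> h * cnj (\<chi> h))"
          unfolding character_add[OF \<open>is_character \<chi>\<close> that h] by (simp only: mult_ac)
        then show ?thesis
          using character_mult_cnj[OF \<open>is_character \<chi>\<close> h] by simp
      qed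
      then have "(\<Sum>g\<in>carrier G. v (g \<oplus> h) * \<chi> g)
          = (\<Sum>g\<in>carrier G. v (g \<oplus> h) * (cnj (\<chi> h) * \<chi> (g \<oplus> h)))"
        by (intro sum.cong) auto
      also have "\<dots> = (\<Sum>g\<in>carrier G. v g * (cnj (\<chi> h) * \<chi> g))"
        by (rule sum.reindex_bij_betw[OF bij_betw_add_right[OF h]])
      also have "\<dots> = cnj (\<chi> h) * (\<Sum>g\<in>carrier G. v g * \<chi> g)"
        by (simp add: sum_distrib_left mult.left_commute)
      finally show ?thesis
        using v that by (simp add: V_def)
    qed
    then show "(\<lambda>g. v (g \<oplus> h)) \<in> V"
      by (simp add: V_def)
  qed
  moreover have "v \<in> V"
    using assms(1) by (simp add: V_def)
  ultimately obtain \<chi> where \<chi>: "\<chi> \<in> V" "is_character \<chi>"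
    using subspace_contains_character assms(2) \<open>v u \<noteq> 0\<close> by blast
  have "(\<Sum>g\<in>carrier G. \<chi> g * cnj (\<chi> g)) = (\<Sum>g\<in>carrier G. 1)"
    using character_mult_cnj[OF \<chi>(2)] by (intro sum.cong) auto
  then have "(\<Sum>g\<in>carrier G. \<chi> g * cnj (\<chi> g)) \<noteq> 0"
    using finite_carrier assms(2) by auto
  then show False
    using \<chi> is_character_cnj by (simp add: V_def)
qed

section \<open>The group ring over the Gaussian integers\<close>

text \<open>The group ring, in the guise of the functions that its elements induce on the characters: sums and
  products of group ring elements become pointwise sums and products.  Values at arguments that are
  not characters are left arbitrary.\<close>

definition character_sums :: "(('a \<Rightarrow> complex) \<Rightarrow> complex) set" where
  "character_sums = {F. \<exists>c. (\<forall>g. c g \<in> gaussian_ints) \<and>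
     (\<forall>\<chi>. is_character \<chi> \<longrightarrow> F \<chi> = (\<Sum>g\<in>carrier G. c g * \<chi> g))}"

lemma character_sumsI:
  assumes "\<And>g. c g \<in> gaussian_ints"
    and "\<And>\<chi>. is_character \<chi> \<Longrightarrow> F \<chi> = (\<Sum>g\<in>carrier G. c g * \<chi> g)"
  shows "F \<in> character_sums"
  using assms by (auto simp: character_sums_def)

lemma character_sums_cong:
  assumes "F \<in> character_sums" "\<And>\<chi>. is_character \<chi> \<Longrightarrow> F \<chi> = F' \<chi>"
  shows "F' \<in> character_sums"
  using assms by (auto simp: character_sums_def)

lemma character_sums_eval:
  assumes "g \<in> carrier G" "a \<in> gaussian_ints"
  shows "(\<lambda>\<chi>. a * \<chi> g) \<in> character_sums"
  by (rule character_sumsI[where c = "\<lambda>h. if h = g then a else 0"])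
     (use assms finite_carrier in \<open>auto simp: gaussian_ints_intros if_distrib[of "\<lambda>x. x * _"] cong: if_cong\<close>)

lemma character_sums_const:
  assumes "a \<in> gaussian_ints"
  shows "(\<lambda>\<chi>. a) \<in> character_sums"
  by (rule character_sums_cong[OF character_sums_eval[OF zero_closed assms]])
     (simp add: character_zero)

lemma character_sums_add:
  assumes "F \<in> character_sums" "F' \<in> character_sums"
  shows "(\<lambda>\<chi>. F \<chi> + F' \<chi>) \<in> character_sums"
proof -
  obtain c c' where "\<And>g. c g \<in> gaussian_ints" "\<And>g. c' g \<in> gaussian_ints"
    and "\<And>\<chi>. is_character \<chi> \<Longrightarrow> F \<chi> = (\<Sum>g\<in>carrier G. c g * \<chi> g)"
    and "\<And>\<chi>. is_character \<chi> \<Longrightarrow> F' \<chi> = (\<Sum>g\<in>carrier G. c' g * \<chi> g)"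
    using assms by (auto simp: character_sums_def)
  then show ?thesis
    by (intro character_sumsI[where c = "\<lambda>g. c g + c' g"])
       (auto simp: gaussian_ints_intros ring_distribs sum.distrib)
qed

lemma character_sums_sum:
  assumes "finite J" "\<And>j. j \<in> J \<Longrightarrow> F j \<in> character_sums"
  shows "(\<lambda>\<chi>. \<Sum>j\<in>J. F j \<chi>) \<in> character_sums"
  using assms
  by (induction J rule: finite_induct)
     (auto intro: character_sums_add character_sums_const gaussian_ints_intros)

lemma character_sums_mult:
  assumes "F \<in> character_sums" "F' \<in> character_sums"
  shows "(\<lambda>\<chi>. F \<chi> * F' \<chi>) \<in> character_sums"
proof -
  obtain c c' where c: "\<And>g. c g \<in> gaussian_ints" "\<And>g. c' g \<in> gaussian_ints"
    and F: "\<And>\<chi>. is_character \<chi> \<Longrightarrow> F \<chi> = (\<Sum>g\<in>carrier G. c g * \<chi> g)"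
    and F': "\<And>\<chi>. is_character \<chi> \<Longrightarrow> F' \<chi> = (\<Sum>g\<in>carrier G. c' g * \<chi> g)"
    using assms by (auto simp: character_sums_def)
  have "(\<lambda>\<chi>. \<Sum>g\<in>carrier G. \<Sum>h\<in>carrier G. (c g * c' h) * \<chi> (g \<oplus> h)) \<in> character_sums"
    using c finite_carrier
    by (intro character_sums_sum character_sums_eval) (auto intro: gaussian_ints_intros)
  then show ?thesis
  proof (rule character_sums_cong)
    fix \<chi> assume \<chi>: "is_character \<chi>"
    have "(\<Sum>g\<in>carrier G. \<Sum>h\<in>carrier G. (c g * c' h) * \<chi> (g \<oplus> h))
        = (\<Sum>g\<in>carrier G. \<Sum>h\<in>carrier G. (c g * \<chi> g) * (c' h * \<chi> h))"
      by (intro sum.cong refl) (simp add: character_add[OF \<chi>])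
    then show "(\<Sum>g\<in>carrier G. \<Sum>h\<in>carrier G. (c g * c' h) * \<chi> (g \<oplus> h)) = F \<chi> * F' \<chi>"
      by (simp add: F[OF \<chi>] F'[OF \<chi>] sum_product)
  qed
qed

lemma character_sums_power:
  assumes "F \<in> character_sums"
  shows "(\<lambda>\<chi>. F \<chi> ^ k) \<in> character_sums"
  by (induction k)
     (use assms in \<open>auto intro: character_sums_const character_sums_mult gaussian_ints_intros\<close>)

text \<open>Division by \<open>p\<close> takes place in the complex numbers; the content is that the quotient is still a
  Gaussian integral combination of characters, that is, that the two sides of
  \<open>(\<Sum>j. F j) ^ p \<equiv> (\<Sum>j. F j ^ p)\<close> agree modulo \<open>p\<close> in the group ring.\<close>

lemma character_sums_freshmans_dream:
  assumes p: "prime p" and "finite J" "\<And>j. j \<in> J \<Longrightarrow> F j \<in> character_sums"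
  shows "(\<lambda>\<chi>. ((\<Sum>j\<in>J. F j \<chi>) ^ p - (\<Sum>j\<in>J. F j \<chi> ^ p)) / of_nat p) \<in> character_sums"
  using assms(2,3)
proof (induction J rule: finite_induct)
  case empty
  have "p > 0" using p prime_gt_0_nat by blast
  then show ?case
    by (auto intro!: character_sums_cong[OF character_sums_const[of 0]] gaussian_ints_intros)
next
  case (insert j J)
  have p0: "p > 0" using p prime_gt_0_nat by blast
  let ?S = "\<lambda>\<chi>. \<Sum>j\<in>J. F j \<chi>" and ?T = "\<lambda>\<chi>. \<Sum>j\<in>J. F j \<chi> ^ p"
  let ?C = "\<lambda>\<chi>. \<Sum>k\<in>{0<..<p}. of_int (int ((p choose k) div p)) * (F j \<chi> ^ k * ?S \<chi> ^ (p - k))"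
  have "?S \<in> character_sums"
    using insert by (intro character_sums_sum) auto
  then have "?C \<in> character_sums"
    using insert
    by (intro character_sums_sum character_sums_mult character_sums_power character_sums_const
        gaussian_ints_intros) auto
  then have "(\<lambda>\<chi>. ?C \<chi> + (?S \<chi> ^ p - ?T \<chi>) / of_nat p) \<in> character_sums"
    using insert by (intro character_sums_add) auto
  then show ?case
  proof (rule character_sums_cong)
    fix \<chi>
    have "(F j \<chi> + ?S \<chi>) ^ p = F j \<chi> ^ p + ?S \<chi> ^ p + of_nat p * ?C \<chi>"
      using prime_power_add_expansion[OF p, of "F j \<chi>" "?S \<chi>"] by (simp add: algebra_simps)
    then show "?C \<chi> + (?S \<chi> ^ p - ?T \<chi>) / of_nat p
        = ((\<Sum>j\<in>insert j J. F j \<chi>) ^ p - (\<Sum>j\<in>insert j J. F j \<chi> ^ p)) / of_nat p"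
      using insert.hyps p0 by (simp add: field_simps)
  qed
qed

text \<open>Fermat's congruence \<open>a ^ p \<equiv> a\<close> holds for each single value of \<open>F\<close>; to hold modulo \<open>p\<close> in the
  group ring it needs one quotient polynomial that serves all values, and hence a bound on them.\<close>

lemma character_sums_fermat:
  assumes "prime p" "p > 2 * N" "F \<in> character_sums"
    and "\<And>\<chi>. is_character \<chi> \<Longrightarrow> F \<chi> \<in> \<int>"
    and "\<And>\<chi>. is_character \<chi> \<Longrightarrow> norm (F \<chi>) \<le> real N"
  shows "(\<lambda>\<chi>. (F \<chi> ^ p - F \<chi>) / of_nat p) \<in> character_sums"
proof -
  obtain r :: "int poly" where r: "\<And>a. \<bar>a\<bar> \<le> int N \<Longrightarrow> a ^ p - a = int p * poly r a"
    using integer_power_diff_eq_prime_mult[OF assms(1,2)] by blast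
  have p0: "p > 0" using assms(1) prime_gt_0_nat by blast
  have "(\<lambda>\<chi>. \<Sum>i\<le>Polynomial.degree r. of_int (poly.coeff r i) * F \<chi> ^ i) \<in> character_sums"
    using assms(3)
    by (intro character_sums_sum character_sums_mult character_sums_power character_sums_const
        gaussian_ints_intros) auto
  then show ?thesis
  proof (rule character_sums_cong)
    fix \<chi> assume \<chi>: "is_character \<chi>"
    obtain a where a: "F \<chi> = of_int a"
      using assms(4)[OF \<chi>] by (auto elim: Ints_cases)
    have "real_of_int \<bar>a\<bar> \<le> real N"
      using assms(5)[OF \<chi>] by (simp add: a)
    then have "\<bar>a\<bar> \<le> int N"
      by (metis of_int_le_iff of_int_of_nat_eq)
    then have "a ^ p - a = int p * poly r a"
      by (rule r)
    then have "(of_int (a ^ p - a) :: complex) = of_int (int p * poly r a)"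
      by simp
    then have "F \<chi> ^ p - F \<chi> = of_nat p * of_int (poly r a)"
      by (simp add: a)
    then show "(\<Sum>i\<le>Polynomial.degree r. of_int (poly.coeff r i) * F \<chi> ^ i)
        = (F \<chi> ^ p - F \<chi>) / of_nat p"
      using p0 by (simp add: a poly_altdef)
  qed
qed

section \<open>Integral Fourier transforms\<close>

definition fourier :: "('a \<Rightarrow> complex) \<Rightarrow> ('a \<Rightarrow> complex) \<Rightarrow> complex" where
  "fourier w \<chi> = (\<Sum>g\<in>carrier G. w g * \<chi> g)"

text \<open>Fermat's and the Frobenius congruence express the \<open>p\<close>-th power of the Fourier transform in two ways
  modulo \<open>p\<close>.  Completeness of the characters makes it possible to compare coefficients, and a difference of two
  numbers of absolute value at most \<open>1\<close> is divisible by \<open>p > 2\<close> only if it is \<open>0\<close>.\<close>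

lemma weight_add_pow_prime:
  assumes w: "\<And>g. w g \<in> {0, 1, \<i>, - \<i>}"
    and int: "\<And>\<chi>. is_character \<chi> \<Longrightarrow> fourier w \<chi> \<in> \<int>"
    and p: "prime p" "p > 2 * card (carrier G)" "coprime p (group_exponent G)"
    and g: "g \<in> carrier G"
  shows "w ([p] \<cdot> g) = w g ^ p"
proof -
  have "card (carrier G) > 0"
    using finite_carrier g card_gt_0_iff by blast
  then have p2: "p > 2" using p(2) by linarith
  have gauss: "w g \<in> gaussian_ints" for g
    using w[of g] by (auto simp: gaussian_ints_def)
  have norm_w: "norm (w g) \<le> 1" for g
    using w[of g] by auto
  obtain l :: nat where l: "\<And>g. g \<in> carrier G \<Longrightarrow> [p] \<cdot> ([l] \<cdot> g) = g"
    "\<And>g. g \<in> carrier G \<Longrightarrow> [l] \<cdot> ([p] \<cdot> g) = g"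
    using exists_inverse_add_pow[OF p(3)] by blast
  \<comment> \<open>The quotients by \<open>p\<close> in Fermat's and in the Frobenius congruence; their difference no longer
    contains the \<open>p\<close>-th power of the transform.\<close>
  let ?E = "\<lambda>\<chi>. (fourier w \<chi> ^ p - fourier w \<chi>) / of_nat p"
  let ?D = "\<lambda>\<chi>. (fourier w \<chi> ^ p - (\<Sum>g\<in>carrier G. (w g * \<chi> g) ^ p)) / of_nat p"
  have D: "?D \<in> character_sums"
    unfolding fourier_def
    using finite_carrier gauss
    by (intro character_sums_freshmans_dream[OF p(1), where F = "\<lambda>g \<chi>. w g * \<chi> g"] character_sums_eval)
  have "norm (fourier w \<chi>) \<le> real (card (carrier G))" if "is_character \<chi>" for \<chi>
  proof -
    have "norm (fourier w \<chi>) \<le> (\<Sum>g\<in>carrier G. norm (w g * \<chi> g))"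
      unfolding fourier_def by (rule norm_sum)
    also have "\<dots> \<le> (\<Sum>g\<in>carrier G. 1)"
      using norm_w norm_character[OF that] by (intro sum_mono) (simp add: norm_mult)
    finally show ?thesis by simp
  qed
  moreover have "fourier w \<in> character_sums"
    unfolding fourier_def using gauss by (intro character_sumsI[of w]) auto
  ultimately have E: "?E \<in> character_sums"
    using character_sums_fermat[OF p(1,2)] int by blast
  have "(\<lambda>\<chi>. ?D \<chi> + (-1) * ?E \<chi>) \<in> character_sums"
    using D E by (intro character_sums_add character_sums_mult character_sums_const)
       (auto intro: gaussian_ints_intros)
  then obtain c where c: "\<And>g. c g \<in> gaussian_ints"
    and sum_c: "\<And>\<chi>. is_character \<chi> \<Longrightarrow> ?D \<chi> + (-1) * ?E \<chi> = (\<Sum>g\<in>carrier G. c g * \<chi> g)"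
    by (auto simp: character_sums_def)
  have zero: "w h - w ([l] \<cdot> h) ^ p - of_nat p * c h = 0" if "h \<in> carrier G" for h
  proof (rule characters_complete[OF _ that])
    fix \<chi> assume \<chi>: "is_character \<chi>"
    have "(\<Sum>h\<in>carrier G. w ([l] \<cdot> h) ^ p * \<chi> h)
        = (\<Sum>g\<in>carrier G. w ([l] \<cdot> ([p] \<cdot> g)) ^ p * \<chi> ([p] \<cdot> g))"
      by (rule sum.reindex_bij_betw[symmetric]) (rule bij_betw_add_pow[OF p(3)])
    also have "\<dots> = (\<Sum>g\<in>carrier G. (w g * \<chi> g) ^ p)"
      using l \<chi> by (intro sum.cong) (auto simp: character_add_pow power_mult_distrib)
    finally have "(\<Sum>h\<in>carrier G. (w h - w ([l] \<cdot> h) ^ p - of_nat p * c h) * \<chi> h)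
        = fourier w \<chi> - (\<Sum>g\<in>carrier G. (w g * \<chi> g) ^ p) - of_nat p * (?D \<chi> + (-1) * ?E \<chi>)"
      unfolding sum_c[OF \<chi>]
      by (simp add: left_diff_distrib sum_subtractf fourier_def sum_distrib_left mult.assoc)
    also have "\<dots> = 0"
      using p2 by (simp add: field_simps)
    finally show "(\<Sum>h\<in>carrier G. (w h - w ([l] \<cdot> h) ^ p - of_nat p * c h) * \<chi> h) = 0" .
  qed
  \<comment> \<open>Multiplication by \<open>l\<close> inverts multiplication by \<open>p\<close>, so this \<open>h\<close> turns the vanishing coefficient
    into the claim for \<open>g\<close>.\<close>
  define h where "h = [p] \<cdot> g"
  have h: "h \<in> carrier G" "[l] \<cdot> h = g"
    using g l by (auto simp: h_def)
  have eq: "w h - w g ^ p = of_nat p * c h"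
    using zero[OF h(1)] h(2) by simp
  have "real p * norm (c h) = norm (w h - w g ^ p)"
    by (simp add: eq norm_mult)
  also have "\<dots> \<le> norm (w h) + norm (w g ^ p)"
    by (rule norm_triangle_ineq4)
  also have "\<dots> \<le> 1 + 1"
    using norm_w[of h] norm_w[of g] by (intro add_mono) (auto simp: norm_power intro: power_le_one)
  finally have "real p * norm (c h) \<le> 2"
    by simp
  moreover have "3 * norm (c h) \<le> real p * norm (c h)"
    using p2 by (intro mult_right_mono) auto
  ultimately have "norm (c h) < 1"
    by linarith
  then have "c h = 0"
    using c gaussian_int_eq_0 by blast
  then show ?thesis
    using eq by (simp add: h_def)
qed

text \<open>Both sides depend only on the residue class of \<open>k\<close> modulo four times the exponent, and the identity
  is multiplicative in \<open>k\<close>.\<close>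

lemma weight_add_pow:
  assumes w: "\<And>g. w g \<in> {0, 1, \<i>, - \<i>}"
    and int: "\<And>\<chi>. is_character \<chi> \<Longrightarrow> fourier w \<chi> \<in> \<int>"
    and k: "coprime k (4 * group_exponent G)" "k > 0"
    and g: "g \<in> carrier G"
  shows "w ([k] \<cdot> g) = w g ^ k"
proof -
  obtain k' where k': "[k' = k] (mod 4 * group_exponent G)" "coprime k' (4 * group_exponent G)" "k' > 0"
    "\<And>q. prime q \<Longrightarrow> q dvd k' \<Longrightarrow> q > 2 * card (carrier G)"
    using cong_with_large_prime_factors[OF k, of "2 * card (carrier G)"] by blast
  have "\<forall>g\<in>carrier G. w ([k'] \<cdot> g) = w g ^ k'"
  proof (rule prime_factor_induct[OF k'(3)])
    fix q assume q: "prime q" "q dvd k'"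
    have "coprime q (group_exponent G)"
      using k'(2) q(2) by (meson coprime_divisors coprime_mult_right_iff dvd_refl)
    then show "\<forall>g\<in>carrier G. w ([q] \<cdot> g) = w g ^ q"
      using weight_add_pow_prime[OF w int q(1) k'(4)[OF q]] by blast
  next
    show "\<forall>g\<in>carrier G. w ([(1::nat)] \<cdot> g) = w g ^ 1"
      by simp
  next
    fix q r :: nat
    assume q: "\<forall>g\<in>carrier G. w ([q] \<cdot> g) = w g ^ q" and r: "\<forall>g\<in>carrier G. w ([r] \<cdot> g) = w g ^ r"
    have "w ([(q * r)] \<cdot> g) = w g ^ (q * r)" if g: "g \<in> carrier G" for g
    proof -
      have "[(q * r)] \<cdot> g = [r] \<cdot> ([q] \<cdot> g)"
        using g by (simp add: add.nat_pow_pow)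
      then show ?thesis
        using q r g by (simp add: power_mult)
    qed
    then show "\<forall>g\<in>carrier G. w ([(q * r)] \<cdot> g) = w g ^ (q * r)" ..
  qed
  moreover have "[k'] \<cdot> g = [k] \<cdot> g"
    using k'(1) by (intro add_pow_cong_group_exponent[OF g]) (rule cong_modulus_mult_nat[of _ _ _ 4], simp add: mult.commute)
  moreover have "[k' = k] (mod 4)"
    using k'(1) by (rule cong_modulus_mult_nat)
  then have "w g ^ k' = w g ^ k"
    using w k'(3) k(2) by (intro power_cong_mod_4) auto
  ultimately show ?thesis
    using g by metis
qed

text \<open>Raising all terms \<open>w g * \<chi> g\<close> to the \<open>k\<close>-th power permutes them, for every \<open>k\<close> coprime to four times
  the exponent.  So the number of these \<open>k\<close> times any power of the Fourier transform is an integer.\<close>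

lemma fourier_in_Ints:
  assumes w: "\<And>g. w g \<in> {0, 1, \<i>, - \<i>}"
    and inv: "\<And>k g. coprime k (4 * group_exponent G) \<Longrightarrow> k > 0 \<Longrightarrow> g \<in> carrier G \<Longrightarrow> w ([k] \<cdot> g) = w g ^ k"
    and \<chi>: "is_character \<chi>"
  shows "fourier w \<chi> \<in> \<int>"
proof (rule in_Ints_of_bounded_denominators)
  let ?N = "4 * group_exponent G"
  \<comment> \<open>Terms with weight \<open>0\<close> are dropped because they are no roots of unity.\<close>
  define S where "S = {g\<in>carrier G. w g \<noteq> 0}"
  show "card (totatives ?N) > 0"
    using group_exponent_pos by (simp add: card_gt_0_iff)
  fix r
  have conj: "(\<Sum>g\<in>S. (w g * \<chi> g) ^ k) = fourier w \<chi>" if "k \<in> totatives ?N" for k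
  proof -
    have k: "coprime k ?N" "k > 0"
      using that by (auto simp: in_totatives_iff)
    then have cop: "coprime k (group_exponent G)"
      by simp
    have "(\<Sum>g\<in>S. (w g * \<chi> g) ^ k) = (\<Sum>g\<in>carrier G. (w g * \<chi> g) ^ k)"
      using finite_carrier k(2) unfolding S_def by (intro sum.mono_neutral_left) (auto simp: zero_power)
    also have "\<dots> = (\<Sum>g\<in>carrier G. w ([k] \<cdot> g) * \<chi> ([k] \<cdot> g))"
      using inv[OF k] \<chi> by (intro sum.cong) (auto simp: power_mult_distrib character_add_pow)
    also have "\<dots> = fourier w \<chi>"
      unfolding fourier_def by (rule sum.reindex_bij_betw[OF bij_betw_add_pow[OF cop]])
    finally show ?thesis .
  qed
  have root: "(w g * \<chi> g) ^ ?N = 1" if "g \<in> S" for g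
  proof -
    have "w g ^ 4 = 1"
      using w[of g] that by (auto simp: S_def power4_eq_xxxx)
    moreover have "\<chi> g ^ group_exponent G = 1"
      using that \<chi> by (intro character_power_group_exponent) (auto simp: S_def)
    ultimately show ?thesis
      by (metis mult.commute power_mult power_mult_distrib power_one mult_1)
  qed
  have "(\<Sum>k\<in>totatives ?N. (\<Sum>g\<in>S. (w g * \<chi> g) ^ k) ^ r) \<in> \<int>"
    using finite_carrier root by (intro sum_totatives_power_sum_power_in_Ints) (auto simp: S_def)
  then show "of_nat (card (totatives ?N)) * fourier w \<chi> ^ r \<in> \<int>"
    using conj by simp
qed

section \<open>Eigenvalues of Cayley graphs\<close>

lemma sum_weight_diff_mult_character:
  assumes \<chi>: "is_character \<chi>" and u: "u \<in> carrier G"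
  shows "(\<Sum>v\<in>carrier G. w (v \<ominus> u) * \<chi> v) = fourier w \<chi> * \<chi> u"
proof -
  have diff: "(s \<oplus> u) \<ominus> u = s" if "s \<in> carrier G" for s
    using that u by (simp add: a_minus_def a_assoc r_neg)
  have "(\<Sum>v\<in>carrier G. w (v \<ominus> u) * \<chi> v) = (\<Sum>s\<in>carrier G. w ((s \<oplus> u) \<ominus> u) * \<chi> (s \<oplus> u))"
    by (rule sum.reindex_bij_betw[symmetric]) (rule bij_betw_add_right[OF u])
  also have "\<dots> = (\<Sum>s\<in>carrier G. w s * \<chi> s * \<chi> u)"
    using u by (intro sum.cong) (auto simp: character_add[OF \<chi>] diff)
  finally show ?thesis
    by (simp add: fourier_def sum_distrib_right)
qed

text \<open>A matrix with entries \<open>w (v - u)\<close> commutes with translations, so its eigenspaces are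
  translation-invariant and contain characters.\<close>

lemma hermitian_eigenvalue_iff_fourier:
  assumes verts: "verts \<Gamma> = carrier G"
    and adj: "\<And>u v. u \<in> carrier G \<Longrightarrow> v \<in> carrier G \<Longrightarrow> hermitian_adj \<Gamma> u v = w (v \<ominus> u)"
  shows "hermitian_eigenvalue \<Gamma> \<mu> \<longleftrightarrow> (\<exists>\<chi>. is_character \<chi> \<and> \<mu> = fourier w \<chi>)"
proof
  assume "hermitian_eigenvalue \<Gamma> \<mu>"
  then obtain x u where u: "u \<in> carrier G" "x u \<noteq> 0"
    and x: "\<And>u. u \<in> carrier G \<Longrightarrow> (\<Sum>v\<in>carrier G. w (v \<ominus> u) * x v) = \<mu> * x u"
    unfolding hermitian_eigenvalue_def verts by (auto simp: adj)
  define V where "V = {x. \<forall>u\<in>carrier G. (\<Sum>v\<in>carrier G. w (v \<ominus> u) * x v) = \<mu> * x u}"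
  have "translation_invariant_subspace V"
    unfolding translation_invariant_subspace_def
  proof (intro conjI ballI allI)
    fix x y c assume "x \<in> V" "y \<in> V"
    then show "(\<lambda>g. x g + c * y g) \<in> V"
      by (simp add: V_def ring_distribs sum.distrib mult.left_commute flip: sum_distrib_left)
  next
    fix x h assume x: "x \<in> V" and h: "h \<in> carrier G"
    have "(\<Sum>v\<in>carrier G. w (v \<ominus> u) * x (v \<oplus> h)) = \<mu> * x (u \<oplus> h)" if u: "u \<in> carrier G" for u
    proof -
      have "v \<ominus> u = (v \<oplus> h) \<ominus> (u \<oplus> h)" if "v \<in> carrier G" for v
      proof -
        have "(v \<oplus> h) \<ominus> (u \<oplus> h) = (v \<ominus> u) \<oplus> (h \<oplus> \<ominus> h)"
          using that u h unfolding a_minus_def by (simp add: minus_add a_ac del: r_neg)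
        then show ?thesis
          using that u h by (simp add: r_neg)
      qed
      then have "(\<Sum>v\<in>carrier G. w (v \<ominus> u) * x (v \<oplus> h))
          = (\<Sum>v\<in>carrier G. w ((v \<oplus> h) \<ominus> (u \<oplus> h)) * x (v \<oplus> h))"
        by (intro sum.cong) auto
      also have "\<dots> = (\<Sum>v\<in>carrier G. w (v \<ominus> (u \<oplus> h)) * x v)"
        by (rule sum.reindex_bij_betw[OF bij_betw_add_right[OF h]])
      also have "\<dots> = \<mu> * x (u \<oplus> h)"
        using x u h by (simp add: V_def)
      finally show ?thesis .
    qed
    then show "(\<lambda>g. x (g \<oplus> h)) \<in> V"
      by (simp add: V_def)
  qed
  moreover have "x \<in> V"
    using x by (simp add: V_def)
  ultimately obtain \<chi> where \<chi>: "\<chi> \<in> V" "is_character \<chi>"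
    using subspace_contains_character u by blast
  then have "\<mu> = fourier w \<chi>"
    using sum_weight_diff_mult_character[OF \<chi>(2) zero_closed, of w] character_zero[OF \<chi>(2)]
    by (simp add: V_def)
  then show "\<exists>\<chi>. is_character \<chi> \<and> \<mu> = fourier w \<chi>"
    using \<chi>(2) by blast
next
  assume "\<exists>\<chi>. is_character \<chi> \<and> \<mu> = fourier w \<chi>"
  then obtain \<chi> where \<chi>: "is_character \<chi>" "\<mu> = fourier w \<chi>" by blast
  have "\<forall>u\<in>carrier G. (\<Sum>v\<in>carrier G. hermitian_adj \<Gamma> u v * \<chi> v) = \<mu> * \<chi> u"
    using sum_weight_diff_mult_character[OF \<chi>(1)] \<chi>(2) by (simp add: adj)
  moreover have "\<chi> \<zero> \<noteq> 0"
    by (simp add: character_zero[OF \<chi>(1)])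
  ultimately show "hermitian_eigenvalue \<Gamma> \<mu>"
    unfolding hermitian_eigenvalue_def verts by blast
qed

end

section \<open>Mixed Cayley graphs\<close>

locale mixed_connection_set = finite_abelian_group G for G (structure) +
  fixes A B :: "'a set"
  assumes A_subset: "A \<subseteq> carrier G" and B_subset: "B \<subseteq> carrier G"
    and disjoint: "A \<inter> B = {}"
    and A_symmetric: "A = a_inv G ` A"
    and B_antisymmetric: "B \<inter> a_inv G ` B = {}"
begin

definition weight :: "'a \<Rightarrow> complex" where
  "weight g = (if g \<in> A then 1 else if g \<in> B then \<i>
               else if g \<in> carrier G \<and> \<ominus> g \<in> B then - \<i> else 0)"

lemma weight_values: "weight g \<in> {0, 1, \<i>, - \<i>}"
  by (simp add: weight_def)

lemma a_inv_mem_A: "g \<in> carrier G \<Longrightarrow> \<ominus> g \<in> A \<longleftrightarrow> g \<in> A"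
  using A_symmetric by (metis imageI minus_minus)

lemma a_inv_notin_B: "g \<in> B \<Longrightarrow> \<ominus> g \<notin> B"
  using B_antisymmetric by blast

lemma weight_eq_1_iff: "weight g = 1 \<longleftrightarrow> g \<in> A"
  by (auto simp: weight_def complex_eq_iff)

lemma weight_eq_ii_iff: "weight g = \<i> \<longleftrightarrow> g \<in> B"
  using disjoint by (auto simp: weight_def complex_eq_iff)

lemma weight_a_inv: "g \<in> carrier G \<Longrightarrow> weight (\<ominus> g) = cnj (weight g)"
  using disjoint a_inv_mem_A[of g] a_inv_notin_B[of g] a_inv_notin_B[of "\<ominus> g"]
  by (auto simp: weight_def)

lemma hermitian_adj_mixed_cayley:
  assumes "u \<in> carrier G" "v \<in> carrier G"
  shows "hermitian_adj (mixed_cayley G A B) u v = weight (v \<ominus> u)"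
proof -
  have d: "v \<ominus> u \<in> carrier G" "u \<ominus> v = \<ominus> (v \<ominus> u)"
    using assms by (simp_all add: minus_diff_eq)
  have "{u, v} \<in> edges (mixed_cayley G A B) \<longleftrightarrow> v \<ominus> u \<in> A \<or> u \<ominus> v \<in> A"
    using assms by (auto simp: mixed_cayley_def doubleton_eq_iff)
  then have "{u, v} \<in> edges (mixed_cayley G A B) \<longleftrightarrow> v \<ominus> u \<in> A"
    using d a_inv_mem_A by auto
  then show ?thesis
    using assms d by (simp add: hermitian_adj_def weight_def mixed_cayley_def)
qed

lemma integral_iff_fourier_in_Ints:
  "integral_mixed_graph (mixed_cayley G A B) \<longleftrightarrow>
     (\<forall>\<chi>. is_character \<chi> \<longrightarrow> fourier weight \<chi> \<in> \<int>)"
proof -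
  have "hermitian_eigenvalue (mixed_cayley G A B) \<mu> \<longleftrightarrow>
      (\<exists>\<chi>. is_character \<chi> \<and> \<mu> = fourier weight \<chi>)" for \<mu>
    by (rule hermitian_eigenvalue_iff_fourier)
       (simp_all add: hermitian_adj_mixed_cayley, simp add: mixed_cayley_def)
  then show ?thesis
    by (auto simp: integral_mixed_graph_def)
qed

lemma integral_iff_weight_add_pow:
  "integral_mixed_graph (mixed_cayley G A B) \<longleftrightarrow>
     (\<forall>k g. coprime k (4 * group_exponent G) \<longrightarrow> k > 0 \<longrightarrow> g \<in> carrier G \<longrightarrow>
        weight ([k] \<cdot> g) = weight g ^ k)"
  unfolding integral_iff_fourier_in_Ints
proof (intro iffI allI impI)
  fix k g
  assume "\<forall>\<chi>. is_character \<chi> \<longrightarrow> fourier weight \<chi> \<in> \<int>"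
    and "coprime k (4 * group_exponent G)" "k > 0" "g \<in> carrier G"
  then show "weight ([k] \<cdot> g) = weight g ^ k"
    by (intro weight_add_pow weight_values) auto
next
  fix \<chi>
  assume "\<forall>k g. coprime k (4 * group_exponent G) \<longrightarrow> k > 0 \<longrightarrow> g \<in> carrier G \<longrightarrow>
      weight ([k] \<cdot> g) = weight g ^ k" and "is_character \<chi>"
  then show "fourier weight \<chi> \<in> \<int>"
    by (intro fourier_in_Ints weight_values) auto
qed

abbreviation (input) "n \<equiv> group_exponent G"

lemma mult_action_nat: "g \<in> carrier G \<Longrightarrow> mult_action G (int k) g = [k] \<cdot> g"
  by (simp add: mult_action_def add_pow_int_ge)

lemma group_action_unit_group_4_exponent:
  "group_action (unit_group (4 * n)) (carrier G) (mult_action G)"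
  using group_exponent_pos by (intro group_action_unit_group) auto

lemma mem_unit_group_iff:
  "k \<in> carrier (unit_group (4 * n)) \<longleftrightarrow> (\<exists>l. k = int l \<and> 0 < l \<and> l < 4 * n \<and> coprime l (4 * n))"
proof -
  have "k \<in> carrier (unit_group (4 * n)) \<longleftrightarrow> 0 < k \<and> k < int (4 * n) \<and> coprime k (int (4 * n))"
    using group_exponent_pos by (subst carrier_unit_group) auto
  also have "\<dots> \<longleftrightarrow> (\<exists>l. k = int l \<and> 0 < l \<and> l < 4 * n \<and> coprime l (4 * n))"
    by (metis coprime_int_iff of_nat_0_less_iff of_nat_less_iff zero_less_imp_eq_int)
  finally show ?thesis .
qed

lemma mem_unit_group_1_mod_4_iff:
  "k \<in> carrier (unit_group_1_mod_4 n) \<longleftrightarrow>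
     (\<exists>l. k = int l \<and> 0 < l \<and> l < 4 * n \<and> coprime l (4 * n) \<and> [l = 1] (mod 4))"
proof -
  have "[int l = 1] (mod 4) \<longleftrightarrow> [l = 1] (mod 4)" for l
    using cong_int_iff[of l 1 4] by simp
  then show ?thesis
    by (auto simp: unit_group_1_mod_4_def mem_unit_group_iff)
qed

lemma mult_action_image_eq_iff:
  assumes "k \<in> carrier (unit_group (4 * n))" "X \<subseteq> carrier G"
  shows "mult_action G k ` X = X \<longleftrightarrow> (\<forall>g\<in>carrier G. mult_action G k g \<in> X \<longleftrightarrow> g \<in> X)"
proof -
  interpret group_action "unit_group (4 * n)" "carrier G" "mult_action G"
    by (rule group_action_unit_group_4_exponent)
  have inj: "inj_on (mult_action G k) (carrier G)"
    by (rule inj_prop[OF assms(1)])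
  show ?thesis
  proof
    assume eq: "mult_action G k ` X = X"
    show "\<forall>g\<in>carrier G. mult_action G k g \<in> X \<longleftrightarrow> g \<in> X"
      using inj_on_image_mem_iff[OF inj _ assms(2)] eq by metis
  next
    assume "\<forall>g\<in>carrier G. mult_action G k g \<in> X \<longleftrightarrow> g \<in> X"
    then have "mult_action G k ` X \<subseteq> X"
      using assms(2) by blast
    moreover have "finite X"
      using assms(2) finite_carrier finite_subset by blast
    ultimately show "mult_action G k ` X = X"
      using inj assms(2) by (meson endo_inj_surj inj_on_subset)
  qed
qed

text \<open>For odd \<open>k\<close> the map \<open>z \<mapsto> z ^ k\<close> fixes \<open>1\<close> and maps no other weight to \<open>1\<close>; for \<open>k \<equiv> 1 (mod 4)\<close> it
  fixes all weights.  The sets \<open>A\<close> and \<open>B\<close> are the fibres of the weight over \<open>1\<close> and \<open>\<i>\<close>.\<close>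

lemma weight_add_pow_imp_invariant:
  assumes W: "\<And>k g. coprime k (4 * n) \<Longrightarrow> k > 0 \<Longrightarrow> g \<in> carrier G \<Longrightarrow> weight ([k] \<cdot> g) = weight g ^ k"
  shows "(\<forall>k\<in>carrier (unit_group (4 * n)). mult_action G k ` A = A) \<and>
         (\<forall>k\<in>carrier (unit_group_1_mod_4 n). mult_action G k ` B = B)"
proof (intro conjI ballI)
  fix k assume k: "k \<in> carrier (unit_group (4 * n))"
  then obtain l where l: "k = int l" "0 < l" "coprime l (4 * n)"
    using mem_unit_group_iff by blast
  have "weight g ^ l = 1 \<longleftrightarrow> weight g = 1" for g
  proof -
    have "[l = 1] (mod 4) \<or> [l = 3] (mod 4)"
      using l(3) by (rule coprime_4_mult_imp_cong_1_or_3)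
    then have "weight g ^ l = weight g ^ 1 \<or> weight g ^ l = weight g ^ 3"
      using power_cong_mod_4[OF weight_values] l(2) by (metis zero_less_one zero_less_numeral)
    then show ?thesis
      using weight_values[of g] by (auto simp: power3_eq_cube complex_eq_iff)
  qed
  then show "mult_action G k ` A = A"
    unfolding mult_action_image_eq_iff[OF k A_subset]
    using W l by (auto simp: mult_action_nat simp flip: weight_eq_1_iff)
next
  fix k assume k: "k \<in> carrier (unit_group_1_mod_4 n)"
  then obtain l where l: "k = int l" "0 < l" "coprime l (4 * n)" "[l = 1] (mod 4)"
    using mem_unit_group_1_mod_4_iff by blast
  have k': "k \<in> carrier (unit_group (4 * n))"
    using k by (simp add: unit_group_1_mod_4_def)
  have "weight g ^ l = weight g" for g
    using power_cong_mod_4[OF weight_values l(4) l(2)] by simp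
  then show "mult_action G k ` B = B"
    unfolding mult_action_image_eq_iff[OF k' B_subset]
    using W l by (auto simp: mult_action_nat simp flip: weight_eq_ii_iff)
qed

text \<open>If \<open>k \<equiv> 3 (mod 4)\<close>, then \<open>- k\<close> is \<open>1\<close> modulo \<open>4\<close> and preserves the weight, while negation conjugates
  it; and conjugation is \<open>z \<mapsto> z ^ 3\<close> on the possible weights.\<close>

lemma invariant_imp_weight_add_pow:
  assumes A: "\<And>k. k \<in> carrier (unit_group (4 * n)) \<Longrightarrow> mult_action G k ` A = A"
    and B: "\<And>k. k \<in> carrier (unit_group_1_mod_4 n) \<Longrightarrow> mult_action G k ` B = B"
    and k: "coprime k (4 * n)" "k > 0" and g: "g \<in> carrier G"
  shows "weight ([k] \<cdot> g) = weight g ^ k"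
proof -
  have one: "weight ([l] \<cdot> g) = weight g"
    if l: "0 < l" "l < 4 * n" "coprime l (4 * n)" "[l = 1] (mod 4)" and g: "g \<in> carrier G" for l g
  proof -
    have U: "int l \<in> carrier (unit_group (4 * n))" and F: "int l \<in> carrier (unit_group_1_mod_4 n)"
      using l mem_unit_group_iff mem_unit_group_1_mod_4_iff by blast+
    have A': "[l] \<cdot> h \<in> A \<longleftrightarrow> h \<in> A" and B': "[l] \<cdot> h \<in> B \<longleftrightarrow> h \<in> B" if "h \<in> carrier G" for h
      using A[OF U] B[OF F] that
      unfolding mult_action_image_eq_iff[OF U A_subset] mult_action_image_eq_iff[OF U B_subset]
      by (auto simp: mult_action_nat)
    have "\<ominus> ([l] \<cdot> g) = [l] \<cdot> (\<ominus> g)"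
      using g by (simp add: add.nat_pow_inv)
    then show ?thesis
      using A'[OF g] B'[OF g] B'[of "\<ominus> g"] g by (simp add: weight_def)
  qed
  define l where "l = k mod (4 * n)"
  have n: "n > 0" by (rule group_exponent_pos)
  have l_cong: "[l = k] (mod (4 * n))"
    by (simp add: l_def cong_def)
  have cop: "coprime l (4 * n)"
    using k(1) l_cong by (metis cong_imp_coprime cong_sym)
  have l: "0 < l" "l < 4 * n"
    using cop n by (auto simp: l_def intro!: Nat.gr0I)
  have l4: "[l = k] (mod 4)"
    using l_cong by (rule cong_modulus_mult_nat)
  have "[k = l] (mod n)"
    by (rule cong_modulus_mult_nat[of _ _ _ 4]) (use l_cong in \<open>simp add: cong_sym mult.commute\<close>)
  then have pow: "[k] \<cdot> g = [l] \<cdot> g"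
    by (rule add_pow_cong_group_exponent[OF g])
  show "weight ([k] \<cdot> g) = weight g ^ k"
  proof (cases "[l = 1] (mod 4)")
    case True
    then have "weight g ^ k = weight g ^ 1"
      using l4 k(2) by (intro power_cong_mod_4[OF weight_values]) (auto simp: cong_def)
    then show ?thesis
      using one[OF l cop True g] pow by simp
  next
    case False
    then have l3: "[l = 3] (mod 4)"
      using coprime_4_mult_imp_cong_1_or_3[OF cop] by blast
    define m where "m = 4 * n - l"
    have m: "0 < m" "m < 4 * n" "m + l = 4 * n"
      using l by (auto simp: m_def)
    have "coprime m (4 * n)"
    proof -
      have "gcd m (4 * n) = gcd m l"
        using gcd_add2[of m l] unfolding m(3) .
      moreover have "gcd l (4 * n) = gcd l m"
        using gcd_add2[of l m] unfolding add.commute[of l m] m(3) .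
      ultimately show ?thesis
        using cop by (metis coprime_iff_gcd_eq_1 gcd.commute)
    qed
    moreover have "[m = 1] (mod 4)"
    proof -
      have "(m + l) mod 4 = 0" "l mod 4 = 3"
        using m(3) l3 by (auto simp: cong_def)
      then have "m mod 4 = 1" by presburger
      then show ?thesis by (simp add: cong_def)
    qed
    ultimately have "weight ([m] \<cdot> g) = weight g"
      using one m g by blast
    moreover have "[l] \<cdot> g = \<ominus> ([m] \<cdot> g)"
    proof -
      have "[l] \<cdot> g \<oplus> [m] \<cdot> g = [(4 * n)] \<cdot> g"
        using g m(3) by (simp add: add.nat_pow_mult add.commute)
      also have "\<dots> = \<zero>"
        using add_pow_cong_group_exponent[OF g, of "4 * n" 0] by (simp add: cong_def)
      finally show ?thesis
        using g minus_equality[of "[l] \<cdot> g" "[m] \<cdot> g"] by simp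
    qed
    ultimately have "weight ([k] \<cdot> g) = cnj (weight g)"
      using pow g by (simp add: weight_a_inv)
    also have "\<dots> = weight g ^ 3"
      using weight_values[of g] by (auto simp: power3_eq_cube)
    also have "\<dots> = weight g ^ k"
      using l3 l4 k(2) by (intro power_cong_mod_4[OF weight_values]) (auto simp: cong_def)
    finally show ?thesis .
  qed
qed

lemma integral_iff_invariant:
  "integral_mixed_graph (mixed_cayley G A B) \<longleftrightarrow>
     (\<forall>k\<in>carrier (unit_group (4 * n)). mult_action G k ` A = A) \<and>
     (\<forall>k\<in>carrier (unit_group_1_mod_4 n). mult_action G k ` B = B)"
  unfolding integral_iff_weight_add_pow
proof (rule iffI, goal_cases)
  case 1
  then show ?case
    by (intro weight_add_pow_imp_invariant) auto
next
  case 2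
  then show ?case
    by (intro allI impI invariant_imp_weight_add_pow) auto
qed

lemma group_action_unit_group_1_mod_4:
  "group_action (unit_group_1_mod_4 n) (carrier G) (mult_action G)"
proof -
  interpret group_action "unit_group (4 * n)" "carrier G" "mult_action G"
    by (rule group_action_unit_group_4_exponent)
  have "unit_group_1_mod_4 n = unit_group (4 * n)\<lparr>carrier := carrier (unit_group_1_mod_4 n)\<rparr>"
    by (simp add: unit_group_1_mod_4_def)
  then show ?thesis
    using induced_action[OF subgroup_unit_group_1_mod_4[OF group_exponent_pos]] by metis
qed

end

theorem theorem3:
  fixes G :: "('g, 'm) ring_scheme" and S A B :: "'g set" and n :: nat
  assumes "abelian_group G" and "finite (carrier G)"
    and "group_exponent G = n"
    and "S = A \<union> B" and "S \<subseteq> carrier G - {\<zero>\<^bsub>G\<^esub>}"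
    and "A \<inter> B = {}"
    and "A = a_inv G ` A"
    and "B \<inter> a_inv G ` B = {}"
  shows "(integral_mixed_graph (mixed_cayley G A B) \<longleftrightarrow>
            (\<forall>k\<in>carrier (unit_group (4 * n)). mult_action G k ` A = A) \<and>
            (\<forall>k\<^sub>1\<in>carrier (unit_group_1_mod_4 n). mult_action G k\<^sub>1 ` B = B))
       \<and> (integral_mixed_graph (mixed_cayley G A B) \<longleftrightarrow>
            (\<exists>\<O>\<subseteq>orbits (unit_group (4 * n)) (carrier G) (mult_action G). A = \<Union>\<O>) \<and>
            (\<exists>\<O>\<subseteq>orbits (unit_group_1_mod_4 n) (carrier G) (mult_action G). B = \<Union>\<O>))"
proof -
  interpret abelian_group G by fact
  interpret mixed_connection_set G A B
    using assms by unfold_locales auto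
  note integral = integral_iff_invariant[unfolded assms(3)]
  have "(\<forall>k\<in>carrier (unit_group (4 * n)). mult_action G k ` A = A) \<longleftrightarrow>
      (\<exists>\<O>\<subseteq>orbits (unit_group (4 * n)) (carrier G) (mult_action G). A = \<Union>\<O>)"
    using group_action.invariant_iff_union_of_orbits[OF group_action_unit_group_4_exponent A_subset]
    by (simp only: assms(3))
  moreover have "(\<forall>k\<in>carrier (unit_group_1_mod_4 n). mult_action G k ` B = B) \<longleftrightarrow>
      (\<exists>\<O>\<subseteq>orbits (unit_group_1_mod_4 n) (carrier G) (mult_action G). B = \<Union>\<O>)"
    using group_action.invariant_iff_union_of_orbits[OF group_action_unit_group_1_mod_4 B_subset]
    by (simp only: assms(3))
  ultimately show ?thesis
    using integral by blast
qed

end
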